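(* Let $\mathbb{K}$ be an algebraically closed field and let $Q$ be a finite, connected, acyclic quiver with $n>1$ vertices. Let $A=\mathbb{K}Q$ be its path algebra and let $B=\mathbb{K}1_A+\operatorname{rad}A$ be the primary arrow subalgebra, where $\operatorname{rad}A$ is the span of all paths of length $\ge 1$. Then the minimum depth is $d(B,A)=4$.
   Context: Path algebra: $A=\mathbb{K}Q$ has as basis all oriented paths in $Q$, including a stationary path $\varepsilon_a$ of length $0$ at each vertex $a$; the product of a path from $a$ to $b$ with a path from $c$ to $d$ (in this order) is their concatenation if $b=c$ and $0$ otherwise. Acyclic means no loops and no oriented cycles; finite means finitely many vertices and arrows (multiple arrows are allowed); connected refers to the underlying graph. Depth: for modules over a ring, $M\mid N$ means $N\cong M\oplus M'$ for some module $M'$, and $M\sim N$ (H-equivalent) means there are natural numbers $r,s\ge 1$ with $N\mid rM$ and $M\mid sN$, where $rM=M\oplus\cdots\oplus M$ ($r$ times). For a unital subring $B\subseteq A$ with $1_B=1_A$, put $C_0(A,B)=B$ (as a $B$-$B$-bimodule) and $C_m(A,B)=A\otimes_B\cdots\otimes_B A$ ($m$ factors $A$) for $m\ge1$, with its natural $A$-$A$-bimodule structure $a(a_1\otimes\cdots\otimes a_m)a'=aa_1\otimes\cdots\otimes a_ma'$ and its restrictions to $A$-$B$-, $B$-$A$-, $B$-$B$-bimodules. The subring $B\subseteq A$ has depth $2m+1$ ($m\ge0$) if $C_{m+1}(A,B)\sim C_m(A,B)$ as $B$-$B$-bimodules; right (resp. left) depth $2m$ ($m\ge1$) if $C_{m+1}(A,B)\sim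 C_m(A,B)$ as $A$-$B$-bimodules (resp. $B$-$A$-bimodules); depth $2m$ if it has both left and right depth $2m$. Left or right depth $2m$ implies depth $2m+1$, and depth $2m+1$ implies depth $2m+2$. The minimum depth $d(B,A)$ is the least $k\ge 1$ such that $k$ is odd and $B\subseteq A$ has depth $k$, or $k$ is even and $B\subseteq A$ has left or right depth $k$; $d(B,A)=\infty$ if there is no such $k$. *)

theory Defs
  imports
    "Graph_Theory.Graph_Theory"
    "HOL-Algebra.Free_Abelian_Groups"
    "HOL-Algebra.AbelCoset"
    "HOL-Algebra.Subrings"
    "HOL-Computational_Algebra.Polynomial"
    "HOL-Library.Extended_Nat"
begin

section \<open>Bimodules\<close>

text \<open>
  As for the record of modules in HOL-Algebra, only the additive part of the underlying ring
  record is meaningful; its fields \<^const>\<open>mult\<close> and \<^const>\<open>one\<close> are irrelevant.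
\<close>

record ('r, 's, 'm) bimod = "'m ring" +
  lact :: "'r \<Rightarrow> 'm \<Rightarrow> 'm"
  ract :: "'m \<Rightarrow> 's \<Rightarrow> 'm"

locale bimodule = R?: ring R + S?: ring S + M?: abelian_group M
  for R :: "('r, 'x) ring_scheme" (structure) and S :: "('s, 'y) ring_scheme" (structure)
    and M :: "('r, 's, 'm, 'z) bimod_scheme" (structure) +
  assumes lact_closed: "\<lbrakk>a \<in> carrier R; x \<in> carrier M\<rbrakk> \<Longrightarrow> lact M a x \<in> carrier M"
    and ract_closed: "\<lbrakk>x \<in> carrier M; b \<in> carrier S\<rbrakk> \<Longrightarrow> ract M x b \<in> carrier M"
    and lact_add_left: "\<lbrakk>a \<in> carrier R; a' \<in> carrier R; x \<in> carrier M\<rbrakk>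
      \<Longrightarrow> lact M (a \<oplus>\<^bsub>R\<^esub> a') x = lact M a x \<oplus>\<^bsub>M\<^esub> lact M a' x"
    and lact_add_right: "\<lbrakk>a \<in> carrier R; x \<in> carrier M; y \<in> carrier M\<rbrakk>
      \<Longrightarrow> lact M a (x \<oplus>\<^bsub>M\<^esub> y) = lact M a x \<oplus>\<^bsub>M\<^esub> lact M a y"
    and ract_add_left: "\<lbrakk>x \<in> carrier M; y \<in> carrier M; b \<in> carrier S\<rbrakk>
      \<Longrightarrow> ract M (x \<oplus>\<^bsub>M\<^esub> y) b = ract M x b \<oplus>\<^bsub>M\<^esub> ract M y b"
    and ract_add_right: "\<lbrakk>x \<in> carrier M; b \<in> carrier S; b' \<in> carrier S\<rbrakk>
      \<Longrightarrow> ract M x (b \<oplus>\<^bsub>S\<^esub> b') = ract M x b \<oplus>\<^bsub>M\<^esub> ract M x b'"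
    and lact_assoc: "\<lbrakk>a \<in> carrier R; a' \<in> carrier R; x \<in> carrier M\<rbrakk>
      \<Longrightarrow> lact M (a \<otimes>\<^bsub>R\<^esub> a') x = lact M a (lact M a' x)"
    and ract_assoc: "\<lbrakk>x \<in> carrier M; b \<in> carrier S; b' \<in> carrier S\<rbrakk>
      \<Longrightarrow> ract M x (b \<otimes>\<^bsub>S\<^esub> b') = ract M (ract M x b) b'"
    and lact_one: "x \<in> carrier M \<Longrightarrow> lact M \<one>\<^bsub>R\<^esub> x = x"
    and ract_one: "x \<in> carrier M \<Longrightarrow> ract M x \<one>\<^bsub>S\<^esub> = x"
    and lact_ract: "\<lbrakk>a \<in> carrier R; x \<in> carrier M; b \<in> carrier S\<rbrakk>
      \<Longrightarrow> ract M (lact M a x) b = lact M a (ract M x b)"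

text \<open>
  The actions are total functions, so the restriction of a bimodule to subrings of \<open>R\<close> and \<open>S\<close>
  is the same record; only the rings over which linearity is required change.
\<close>

definition bimod_isomorphic ::
  "('r, 'x) ring_scheme \<Rightarrow> ('s, 'y) ring_scheme \<Rightarrow> ('r, 's, 'm) bimod \<Rightarrow> ('r, 's, 'n) bimod \<Rightarrow> bool"
where
  "bimod_isomorphic R S M N \<longleftrightarrow>
    (\<exists>h \<in> iso (add_monoid M) (add_monoid N).
      (\<forall>a \<in> carrier R. \<forall>x \<in> carrier M. h (lact M a x) = lact N a (h x)) \<and>
      (\<forall>b \<in> carrier S. \<forall>x \<in> carrier M. h (ract M x b) = ract N (h x) b))"

definition bimod_sum ::
  "('r, 's, 'm) bimod \<Rightarrow> ('r, 's, 'n) bimod \<Rightarrow> ('r, 's, 'm \<times> 'n) bimod"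
where
  "bimod_sum M N =
    \<lparr>carrier = carrier M \<times> carrier N, mult = undefined, one = undefined,
     zero = (\<zero>\<^bsub>M\<^esub>, \<zero>\<^bsub>N\<^esub>),
     add = (\<lambda>(x, y) (x', y'). (x \<oplus>\<^bsub>M\<^esub> x', y \<oplus>\<^bsub>N\<^esub> y')),
     lact = (\<lambda>a (x, y). (lact M a x, lact N a y)),
     ract = (\<lambda>(x, y) b. (ract M x b, ract N y b))\<rparr>"

definition bimod_power :: "nat \<Rightarrow> ('r, 's, 'm) bimod \<Rightarrow> ('r, 's, nat \<Rightarrow> 'm) bimod" where
  "bimod_power r M =
    \<lparr>carrier = {..<r} \<rightarrow>\<^sub>E carrier M, mult = undefined, one = undefined,
     zero = (\<lambda>i\<in>{..<r}. \<zero>\<^bsub>M\<^esub>),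
     add = (\<lambda>f g. \<lambda>i\<in>{..<r}. f i \<oplus>\<^bsub>M\<^esub> g i),
     lact = (\<lambda>a f. \<lambda>i\<in>{..<r}. lact M a (f i)),
     ract = (\<lambda>f b. \<lambda>i\<in>{..<r}. ract M (f i) b)\<rparr>"

text \<open>
  The relation \<open>M | N\<close>. The complement \<open>M'\<close> ranges over bimodules on the element type of \<open>N\<close>;
  this loses nothing, since a complement embeds into \<open>N\<close> (see \<open>bimod_dividesI\<close> below).
\<close>

definition bimod_divides ::
  "('r, 'x) ring_scheme \<Rightarrow> ('s, 'y) ring_scheme \<Rightarrow> ('r, 's, 'm) bimod \<Rightarrow> ('r, 's, 'n) bimod \<Rightarrow> bool"
where
  "bimod_divides R S M N \<longleftrightarrow>
    (\<exists>M' :: ('r, 's, 'n) bimod. bimodule R S M' \<and> bimod_isomorphic R S N (bimod_sum M M'))"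

lemma bimod_dividesI:
  fixes N :: "('r, 's, 'n) bimod" and X :: "('r, 's, 'z) bimod"
  assumes M: "bimodule R S M" and X: "bimodule R S X"
    and iso: "bimod_isomorphic R S N (bimod_sum M X)"
  shows "bimod_divides R S M N"
proof -
  interpret M: bimodule R S M by (rule M)
  interpret X: bimodule R S X by (rule X)
  obtain h where h: "h \<in> iso (add_monoid N) (add_monoid (bimod_sum M X))"
    and hl: "\<And>a x. a \<in> carrier R \<Longrightarrow> x \<in> carrier N \<Longrightarrow> h (lact N a x) = lact (bimod_sum M X) a (h x)"
    and hr: "\<And>b x. b \<in> carrier S \<Longrightarrow> x \<in> carrier N \<Longrightarrow> h (ract N x b) = ract (bimod_sum M X) (h x) b"
    using iso by (auto simp: bimod_isomorphic_def)
  have hb: "bij_betw h (carrier N) (carrier M \<times> carrier X)"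
    and ha: "\<And>x y. x \<in> carrier N \<Longrightarrow> y \<in> carrier N \<Longrightarrow> h (x \<oplus>\<^bsub>N\<^esub> y) = h x \<oplus>\<^bsub>bimod_sum M X\<^esub> h y"
    using h by (auto simp: iso_def hom_def bimod_sum_def)
  define j where "j y = inv_into (carrier N) h (\<zero>\<^bsub>M\<^esub>, y)" for y
  have "inj_on j (carrier X)"
    using bij_betw_inv_into[OF hb] by (auto simp: inj_on_def j_def bij_betw_def)
  then obtain k where kj: "\<And>y. y \<in> carrier X \<Longrightarrow> k (j y) = y"
    by (metis inv_into_f_f)
  define M' :: "('r, 's, 'n) bimod" where "M' =
    \<lparr>carrier = j ` carrier X, mult = undefined, one = undefined, zero = j \<zero>\<^bsub>X\<^esub>,
     add = (\<lambda>u v. j (k u \<oplus>\<^bsub>X\<^esub> k v)), lact = (\<lambda>a u. j (lact X a (k u))),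
     ract = (\<lambda>u b. j (ract X (k u) b))\<rparr>"
  have ag: "abelian_group M'"
  proof (rule abelian_groupI, goal_cases)
    case (6 x)
    then obtain y where "y \<in> carrier X" "x = j y" by (auto simp: M'_def)
    then show ?case
      by (intro bexI[of _ "j (\<ominus>\<^bsub>X\<^esub> y)"]) (auto simp: M'_def kj X.l_neg)
  qed (auto simp: M'_def kj X.a_ac)
  have "bimodule R S M'"
  proof -
    interpret M': abelian_group M' by (rule ag)
    show ?thesis
      by unfold_locales
        (auto simp: M'_def kj X.lact_closed X.ract_closed X.lact_add_left X.lact_add_right
          X.ract_add_left X.ract_add_right X.lact_assoc X.ract_assoc X.lact_one X.ract_one X.lact_ract)
  qed
  moreover have "bimod_isomorphic R S N (bimod_sum M M')"
    unfolding bimod_isomorphic_def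
  proof (intro bexI[of _ "\<lambda>x. (fst (h x), j (snd (h x)))"] conjI ballI)
    have mem: "fst (h x) \<in> carrier M" "snd (h x) \<in> carrier X" if "x \<in> carrier N" for x
      using bij_betw_apply[OF hb that] by auto
    have "bij_betw j (carrier X) (j ` carrier X)"
      using \<open>inj_on j (carrier X)\<close> by (rule inj_on_imp_bij_betw)
    then have "bij_betw (map_prod id j) (carrier M \<times> carrier X) (carrier M \<times> j ` carrier X)"
      by (intro bij_betw_map_prod) auto
    from bij_betw_trans[OF hb this]
    have bij: "bij_betw (\<lambda>x. (fst (h x), j (snd (h x)))) (carrier N) (carrier M \<times> j ` carrier X)"
      by (simp add: comp_def map_prod_def case_prod_unfold)
    show "(\<lambda>x. (fst (h x), j (snd (h x)))) \<in> iso (add_monoid N) (add_monoid (bimod_sum M M'))"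
      using bij by (auto simp: iso_def hom_def bimod_sum_def M'_def ha kj mem case_prod_unfold)
    fix x assume x: "x \<in> carrier N"
    show "(fst (h (lact N a x)), j (snd (h (lact N a x)))) =
        lact (bimod_sum M M') a (fst (h x), j (snd (h x)))" if "a \<in> carrier R" for a
      by (simp add: hl[OF that x] bimod_sum_def M'_def case_prod_unfold kj mem x)
    show "(fst (h (ract N x b)), j (snd (h (ract N x b)))) =
        ract (bimod_sum M M') (fst (h x), j (snd (h x))) b" if "b \<in> carrier S" for b
      by (simp add: hr[OF that x] bimod_sum_def M'_def case_prod_unfold kj mem x)
  qed
  ultimately show ?thesis by (auto simp: bimod_divides_def)
qed

definition H_equivalent ::
  "('r, 'x) ring_scheme \<Rightarrow> ('s, 'y) ring_scheme \<Rightarrow> ('r, 's, 'm) bimod \<Rightarrow> ('r, 's, 'n) bimod \<Rightarrow> bool"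
where
  "H_equivalent R S M N \<longleftrightarrow>
    (\<exists>r s. r \<ge> 1 \<and> s \<ge> 1 \<and>
      bimod_divides R S N (bimod_power r M) \<and> bimod_divides R S M (bimod_power s N))"


section \<open>Tensor powers and depth of a subring\<close>

text \<open>
  The tensor power of \<open>m \<ge> 1\<close> factors \<open>A\<close> over \<open>B\<close> is the free abelian group on the lists
  \<open>[a\<^sub>1, \<dots>, a\<^sub>m]\<close> over \<open>A\<close>, modulo additivity in each entry and
  \<open>B\<close>-balancedness between neighbouring entries.
\<close>

definition tensor_gens :: "('a, 'z) ring_scheme \<Rightarrow> nat \<Rightarrow> 'a list set" where
  "tensor_gens A m = {xs. length xs = m \<and> set xs \<subseteq> carrier A}"

definition tensor_rels :: "'a set \<Rightarrow> ('a, 'z) ring_scheme \<Rightarrow> nat \<Rightarrow> ('a list \<Rightarrow>\<^sub>0 int) set" where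
  "tensor_rels B A m =
    {frag_of (us @ [x \<oplus>\<^bsub>A\<^esub> y] @ vs) - frag_of (us @ [x] @ vs) - frag_of (us @ [y] @ vs) |us x y vs.
        us @ [x] @ vs \<in> tensor_gens A m \<and> y \<in> carrier A} \<union>
    {frag_of (us @ [x \<otimes>\<^bsub>A\<^esub> b, y] @ vs) - frag_of (us @ [x, b \<otimes>\<^bsub>A\<^esub> y] @ vs) |us x b y vs.
        us @ [x, y] @ vs \<in> tensor_gens A m \<and> b \<in> B}"

definition tensor_kernel :: "'a set \<Rightarrow> ('a, 'z) ring_scheme \<Rightarrow> nat \<Rightarrow> ('a list \<Rightarrow>\<^sub>0 int) set" where
  "tensor_kernel B A m = generate (free_Abelian_group (tensor_gens A m)) (tensor_rels B A m)"

text \<open>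
  Elements are cosets; the actions are
  \<open>a (a\<^sub>1 \<otimes> \<dots> \<otimes> a\<^sub>m) a' = a a\<^sub>1 \<otimes> \<dots> \<otimes> a\<^sub>m a'\<close>, extended additively to representatives.
\<close>

definition tensor_power ::
  "'a set \<Rightarrow> ('a, 'z) ring_scheme \<Rightarrow> nat \<Rightarrow> ('a, 'a, ('a list \<Rightarrow>\<^sub>0 int) set) bimod"
where
  "tensor_power B A m =
    (let F = free_Abelian_group (tensor_gens A m); K = tensor_kernel B A m in
    \<lparr>carrier = carrier (F Mod K), mult = undefined, one = undefined,
     zero = one (F Mod K),
     add = mult (F Mod K),
     lact = (\<lambda>a X. \<Union>f\<in>X. K #>\<^bsub>F\<^esub> frag_extend (\<lambda>xs. frag_of ((a \<otimes>\<^bsub>A\<^esub> hd xs) # tl xs)) f),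
     ract = (\<lambda>X a. \<Union>f\<in>X. K #>\<^bsub>F\<^esub> frag_extend (\<lambda>xs. frag_of (butlast xs @ [last xs \<otimes>\<^bsub>A\<^esub> a])) f)\<rparr>)"

definition subring_bimod :: "'a set \<Rightarrow> ('a, 'z) ring_scheme \<Rightarrow> ('a, 'a, 'a) bimod" where
  "subring_bimod B A =
    \<lparr>carrier = B, mult = undefined, one = undefined, zero = \<zero>\<^bsub>A\<^esub>, add = add A,
     lact = mult A, ract = mult A\<rparr>"

text \<open>Depth \<open>2 m + 1\<close>; the case \<open>m = 0\<close> is separate because \<open>C\<^sub>0(A, B) = B\<close> has a different element type.\<close>

definition odd_depth :: "'a set \<Rightarrow> ('a, 'z) ring_scheme \<Rightarrow> nat \<Rightarrow> bool" where
  "odd_depth B A m \<longleftrightarrow>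
    (if m = 0
     then H_equivalent (A\<lparr>carrier := B\<rparr>) (A\<lparr>carrier := B\<rparr>) (tensor_power B A 1) (subring_bimod B A)
     else H_equivalent (A\<lparr>carrier := B\<rparr>) (A\<lparr>carrier := B\<rparr>)
            (tensor_power B A (m + 1)) (tensor_power B A m))"

text \<open>Right and left depth \<open>2 m\<close>, for \<open>m \<ge> 1\<close>.\<close>

definition right_even_depth :: "'a set \<Rightarrow> ('a, 'z) ring_scheme \<Rightarrow> nat \<Rightarrow> bool" where
  "right_even_depth B A m \<longleftrightarrow>
    H_equivalent A (A\<lparr>carrier := B\<rparr>) (tensor_power B A (m + 1)) (tensor_power B A m)"

definition left_even_depth :: "'a set \<Rightarrow> ('a, 'z) ring_scheme \<Rightarrow> nat \<Rightarrow> bool" where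
  "left_even_depth B A m \<longleftrightarrow>
    H_equivalent (A\<lparr>carrier := B\<rparr>) A (tensor_power B A (m + 1)) (tensor_power B A m)"

text \<open>The infimum of the empty set in \<^typ>\<open>enat\<close> is \<open>\<infinity>\<close>.\<close>

definition min_depth :: "'a set \<Rightarrow> ('a, 'z) ring_scheme \<Rightarrow> enat" where
  "min_depth B A =
    Inf {enat k |k. (\<exists>m. k = 2 * m + 1 \<and> odd_depth B A m) \<or>
                    (\<exists>m\<ge>1. k = 2 * m \<and> (left_even_depth B A m \<or> right_even_depth B A m))}"


section \<open>Path algebras\<close>

text \<open>
  A quiver is a digraph. A path from \<open>u\<close> to \<open>v\<close> is a triple \<open>(u, p, v)\<close> with \<open>p\<close> its list of arrows;
  the stationary path at \<open>u\<close> is \<open>(u, [], u)\<close>.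
\<close>

definition paths :: "('v, 'e) pre_digraph \<Rightarrow> ('v \<times> 'e list \<times> 'v) set" where
  "paths Q = {(u, p, v). pre_digraph.awalk Q u p v}"

fun path_mult :: "'v \<times> 'e list \<times> 'v \<Rightarrow> 'v \<times> 'e list \<times> 'v \<Rightarrow> 'v \<times> 'e list \<times> 'v \<Rightarrow>\<^sub>0 'k::field" where
  "path_mult (a, p, b) (c, q, d) = (if b = c then Poly_Mapping.single (a, p @ q, d) 1 else 0)"

definition pscale :: "'k \<Rightarrow> ('p \<Rightarrow>\<^sub>0 'k) \<Rightarrow> ('p \<Rightarrow>\<^sub>0 'k::field)" where
  "pscale c f = Poly_Mapping.map ((*) c) f"

text \<open>The unit is the sum of the stationary paths, which requires finitely many vertices.\<close>

definition path_algebra :: "('v, 'e) pre_digraph \<Rightarrow> ('v \<times> 'e list \<times> 'v \<Rightarrow>\<^sub>0 'k::field) ring" where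
  "path_algebra Q =
    \<lparr>carrier = {f. Poly_Mapping.keys f \<subseteq> paths Q},
     mult = (\<lambda>f g. \<Sum>x\<in>Poly_Mapping.keys f. \<Sum>y\<in>Poly_Mapping.keys g.
       pscale (Poly_Mapping.lookup f x * Poly_Mapping.lookup g y) (path_mult x y)),
     one = (\<Sum>v\<in>verts Q. Poly_Mapping.single (v, [], v) 1),
     zero = 0, add = (+)\<rparr>"

definition path_rad :: "('v, 'e) pre_digraph \<Rightarrow> ('v \<times> 'e list \<times> 'v \<Rightarrow>\<^sub>0 'k::field) set" where
  "path_rad Q = {f. Poly_Mapping.keys f \<subseteq> {(u, p, v) \<in> paths Q. length p \<ge> 1}}"

definition primary_arrow_subalgebra ::
  "('v, 'e) pre_digraph \<Rightarrow> ('v \<times> 'e list \<times> 'v \<Rightarrow>\<^sub>0 'k::field) set"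
where
  "primary_arrow_subalgebra Q = {pscale c \<one>\<^bsub>path_algebra Q\<^esub> + f |c f. f \<in> path_rad Q}"

definition acyclic_quiver :: "('v, 'e) pre_digraph \<Rightarrow> bool" where
  "acyclic_quiver Q \<longleftrightarrow> \<not> (\<exists>p. pre_digraph.cycle Q p)"

end

theory Submission
  imports Defs
begin

text \<open>
  Let \<open>J\<close> be the radical, so that \<open>B = K1 + J\<close>, and let \<open>e\<^sub>i\<close> be the stationary paths. Every element
  \<open>a \<otimes> b - ab \<otimes> 1\<close> of \<open>A \<otimes>\<^sub>B A\<close> is annihilated by \<open>J\<close> on the right, since \<open>bx \<in> J \<subseteq> B\<close> for \<open>x \<in> J\<close>, and
  these elements span the kernel \<open>\<Omega>\<close> of the multiplication of \<open>A\<close>. Hence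
  \<open>A \<otimes>\<^sub>B A \<otimes>\<^sub>B A = (A \<otimes>\<^sub>B A) \<oplus> (\<Omega> \<otimes>\<^sub>B A)\<close>, where \<open>\<Omega> \<otimes>\<^sub>B A = \<Omega> \<otimes>\<^sub>K A/J\<close> is a sum of copies of \<open>\<Omega>\<close>
  as an \<open>A\<close>-\<open>B\<close>-bimodule; as \<open>\<Omega> | A \<otimes>\<^sub>B A\<close>, this gives right depth 4.

  For \<open>i \<noteq> j\<close> the element \<open>e\<^sub>i \<otimes> e\<^sub>j\<close> of \<open>A \<otimes>\<^sub>B A\<close> is annihilated by \<open>J\<close> on both sides. Since every vertex
  has an incident arrow, the elements of \<open>A\<close> with this property lie in \<open>J\<close>. A split embedding of
  \<open>A \<otimes>\<^sub>B A\<close> into \<open>sA\<close> as \<open>B\<close>-\<open>B\<close>-bimodules would therefore yield \<open>e\<^sub>i \<otimes> e\<^sub>j \<in> J (A \<otimes>\<^sub>B A)\<close>, which is refuted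
  by the functional \<open>a \<otimes> b \<mapsto> \<pi>\<^sub>i(a) \<pi>\<^sub>j(b)\<close>, where \<open>\<pi>\<^sub>i\<close> takes the coefficient of \<open>e\<^sub>i\<close>. So depth 3, and with
  it depth 2, fails. Depth 1 is excluded in the same way, using \<open>e\<^sub>i \<in> A\<close>, the bimodule \<open>B\<close>, and that
  there are no loops.
\<close>

section \<open>Direct summands of bimodules\<close>

lemma bimodule_subring:
  assumes M: "bimodule R S M" and R': "subring R' R" and S': "subring S' S"
  shows "bimodule (R\<lparr>carrier := R'\<rparr>) (S\<lparr>carrier := S'\<rparr>) M"
proof -
  interpret bimodule R S M by (rule M)
  interpret R': ring "R\<lparr>carrier := R'\<rparr>" by (rule R.subring_is_ring[OF R'])
  interpret S': ring "S\<lparr>carrier := S'\<rparr>" by (rule S.subring_is_ring[OF S'])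
  have R: "a \<in> carrier R" if "a \<in> R'" for a using subringE(1)[OF R'] that by auto
  have S: "a \<in> carrier S" if "a \<in> S'" for a using subringE(1)[OF S'] that by auto
  show ?thesis
    by unfold_locales
      (auto simp: R S lact_closed ract_closed lact_add_left lact_add_right
        ract_add_left ract_add_right lact_assoc ract_assoc lact_one ract_one lact_ract)
qed

lemma bimod_isomorphic_mono:
  assumes "bimod_isomorphic R S M N" "carrier R' \<subseteq> carrier R" "carrier S' \<subseteq> carrier S"
  shows "bimod_isomorphic R' S' M N"
  using assms unfolding bimod_isomorphic_def by (meson subset_iff)

text \<open>The complement restricts along with the isomorphism. This carries the failure of
  divisibility over \<open>B\<close> and \<open>B\<close> to the even depths, where one of the two
  sides is \<open>A\<close>.\<close>

lemma bimod_divides_subring: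
  fixes N :: "('r, 's, 'n) bimod"
  assumes "bimod_divides R S M N" "subring R' R" "subring S' S"
  shows "bimod_divides (R\<lparr>carrier := R'\<rparr>) (S\<lparr>carrier := S'\<rparr>) M N"
proof -
  obtain X :: "('r, 's, 'n) bimod" where "bimodule R S X" "bimod_isomorphic R S N (bimod_sum M X)"
    using assms(1) unfolding bimod_divides_def by blast
  note X = this
  have "bimod_isomorphic (R\<lparr>carrier := R'\<rparr>) (S\<lparr>carrier := S'\<rparr>) N (bimod_sum M X)"
    by (rule bimod_isomorphic_mono[OF X(2)]) (use assms(2,3)[THEN subringE(1)] in simp_all)
  with bimodule_subring[OF X(1) assms(2,3)] show ?thesis unfolding bimod_divides_def by blast
qed

section \<open>Homomorphisms of bimodules and of their additive groups\<close>

definition bimod_hom ::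
  "('r, 'x) ring_scheme \<Rightarrow> ('s, 'y) ring_scheme \<Rightarrow> ('r, 's, 'm) bimod \<Rightarrow> ('r, 's, 'n) bimod \<Rightarrow> ('m \<Rightarrow> 'n) set"
where
  "bimod_hom R S M N =
    {h \<in> hom (add_monoid M) (add_monoid N).
      (\<forall>a \<in> carrier R. \<forall>x \<in> carrier M. h (lact M a x) = lact N a (h x)) \<and>
      (\<forall>b \<in> carrier S. \<forall>x \<in> carrier M. h (ract M x b) = ract N (h x) b)}"

lemma bimod_homI:
  assumes "h \<in> hom (add_monoid M) (add_monoid N)"
    "\<And>a x. a \<in> carrier R \<Longrightarrow> x \<in> carrier M \<Longrightarrow> h (lact M a x) = lact N a (h x)"
    "\<And>b x. b \<in> carrier S \<Longrightarrow> x \<in> carrier M \<Longrightarrow> h (ract M x b) = ract N (h x) b"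
  shows "h \<in> bimod_hom R S M N"
  using assms by (auto simp: bimod_hom_def)

lemma add_hom_closed: "h \<in> hom (add_monoid M) (add_monoid N) \<Longrightarrow> x \<in> carrier M \<Longrightarrow> h x \<in> carrier N"
  by (auto simp: hom_def)

lemma add_hom_add:
  "h \<in> hom (add_monoid M) (add_monoid N) \<Longrightarrow> x \<in> carrier M \<Longrightarrow> y \<in> carrier M
    \<Longrightarrow> h (x \<oplus>\<^bsub>M\<^esub> y) = h x \<oplus>\<^bsub>N\<^esub> h y"
  by (auto simp: hom_def)

lemma add_hom_group_hom:
  assumes "h \<in> hom (add_monoid M) (add_monoid N)" "abelian_group M" "abelian_group N"
  shows "group_hom (add_monoid M) (add_monoid N) h"
  using assms by (simp add: group_hom_def group_hom_axioms_def abelian_group.a_group)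

lemma add_hom_zero:
  assumes "h \<in> hom (add_monoid M) (add_monoid N)" "abelian_group M" "abelian_group N"
  shows "h \<zero>\<^bsub>M\<^esub> = \<zero>\<^bsub>N\<^esub>"
  using group_hom.hom_one[OF add_hom_group_hom[OF assms]] by simp

lemma add_hom_minus:
  assumes "h \<in> hom (add_monoid M) (add_monoid N)" "abelian_group M" "abelian_group N" "x \<in> carrier M"
  shows "h (\<ominus>\<^bsub>M\<^esub> x) = \<ominus>\<^bsub>N\<^esub> h x"
  using group_hom.hom_inv[OF add_hom_group_hom[OF assms(1-3)], of x] assms(4)
  by (simp add: a_inv_def)

lemma add_hom_diff:
  assumes "h \<in> hom (add_monoid M) (add_monoid N)" "abelian_group M" "abelian_group N"
    "x \<in> carrier M" "y \<in> carrier M"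
  shows "h (x \<ominus>\<^bsub>M\<^esub> y) = h x \<ominus>\<^bsub>N\<^esub> h y"
  using assms by (simp add: a_minus_def add_hom_add[OF assms(1)] add_hom_minus[OF assms(1)] abelian_group.a_inv_closed)

lemma add_hom_finsum:
  assumes h: "h \<in> hom (add_monoid M) (add_monoid N)" and M: "abelian_group M" and N: "abelian_group N"
    and f: "\<And>i. i \<in> I \<Longrightarrow> f i \<in> carrier M"
  shows "h (finsum M f I) = finsum N (\<lambda>i. h (f i)) I"
proof -
  interpret M: abelian_group M by (rule M)
  interpret N: abelian_group N by (rule N)
  show ?thesis using f
  proof (induction I rule: infinite_finite_induct)
    case (insert i I)
    then have "f \<in> I \<rightarrow> carrier M" "(\<lambda>i. h (f i)) \<in> I \<rightarrow> carrier N"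
      using add_hom_closed[OF h] by auto
    then show ?case using insert by (simp add: add_hom_add[OF h] add_hom_closed[OF h])
  qed (simp_all add: add_hom_zero[OF h M N])
qed

lemma (in abelian_group) add_hom_finsum_pointwise:
  assumes "\<And>i. i \<in> I \<Longrightarrow> f i \<in> hom (add_monoid M) (add_monoid G)" 
  shows "(\<lambda>x. finsum G (\<lambda>i. f i x) I) \<in> hom (add_monoid M) (add_monoid G)"
proof (rule homI)
  fix x assume "x \<in> carrier (add_monoid M)"
  then show "(\<Oplus>i\<in>I. f i x) \<in> carrier (add_monoid G)"
    using assms by (auto intro!: finsum_closed simp: hom_def)
next
  fix x y assume "x \<in> carrier (add_monoid M)" "y \<in> carrier (add_monoid M)"
  then have *: "(\<lambda>i. f i x) \<in> I \<rightarrow> carrier G" "(\<lambda>i. f i y) \<in> I \<rightarrow> carrier G"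
    "\<And>i. i \<in> I \<Longrightarrow> f i (x \<oplus>\<^bsub>M\<^esub> y) = f i x \<oplus> f i y" using assms by (auto simp: hom_def)
  have "(\<Oplus>i\<in>I. f i (x \<oplus>\<^bsub>M\<^esub> y)) = (\<Oplus>i\<in>I. f i x \<oplus> f i y)"
    by (rule finsum_cong') (use * in auto)
  then show "(\<Oplus>i\<in>I. f i (x \<otimes>\<^bsub>add_monoid M\<^esub> y)) = (\<Oplus>i\<in>I. f i x) \<otimes>\<^bsub>add_monoid G\<^esub> (\<Oplus>i\<in>I. f i y)"
    by (simp add: finsum_addf[OF *(1,2)])
qed

context bimodule begin

lemma lact_hom: "a \<in> carrier R \<Longrightarrow> lact M a \<in> hom (add_monoid M) (add_monoid M)"
  by (auto simp: hom_def lact_closed lact_add_right)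

lemma ract_hom: "b \<in> carrier S \<Longrightarrow> (\<lambda>x. ract M x b) \<in> hom (add_monoid M) (add_monoid M)"
  by (auto simp: hom_def ract_closed ract_add_left)

lemma abelian: "abelian_group M"
  by unfold_locales

text \<open>A stable additive subgroup is a sub-bimodule. The case needed is the kernel of a
  retraction, which serves as the complement of a direct summand.\<close>

lemma bimodule_carrier_restrict:
  assumes "subgroup H (add_monoid M)"
    and "\<And>a x. a \<in> carrier R \<Longrightarrow> x \<in> H \<Longrightarrow> lact M a x \<in> H"
    and "\<And>b x. b \<in> carrier S \<Longrightarrow> x \<in> H \<Longrightarrow> ract M x b \<in> H"
  shows "bimodule R S (M\<lparr>carrier := H\<rparr>)"
proof -
  have H: "x \<in> carrier M" if "x \<in> H" for x using subgroup.subset[OF assms(1)] that by auto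
  have "abelian_group (M\<lparr>carrier := H\<rparr>)"
  proof (rule abelian_groupI, goal_cases)
    case (6 x)
    then show ?case
      using subgroup.m_inv_closed[OF assms(1)] 
      by (intro bexI[of _ "\<ominus>\<^bsub>M\<^esub> x"]) (auto simp: a_inv_def[symmetric] M.l_neg H)
  qed (use subgroup.m_closed[OF assms(1)] subgroup.one_closed[OF assms(1)] in \<open>auto simp: M.a_ac H\<close>)
  then interpret P: abelian_group "M\<lparr>carrier := H\<rparr>" .
  show ?thesis
    by unfold_locales (auto simp: H assms(2,3)
          lact_add_left lact_add_right
          ract_add_left ract_add_right lact_assoc ract_assoc lact_one ract_one lact_ract)
qed

end

lemma bimod_hom_zero:
  assumes "h \<in> bimod_hom R S M N" "bimodule R S M" "bimodule R S N"
  shows "h \<zero>\<^bsub>M\<^esub> = \<zero>\<^bsub>N\<^esub>"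
  using assms by (intro add_hom_zero bimodule.abelian) (auto simp: bimod_hom_def)

section \<open>Powers of a bimodule, and criteria for and against divisibility\<close>

lemma bimodule_power:
  assumes "bimodule R S M"
  shows "bimodule R S (bimod_power r M)"
proof -
  interpret bimodule R S M by (rule assms)
  let ?P = "bimod_power r M"
  \<comment> \<open>Elements of the power are extensional functions on \<open>{..<r}\<close>, so all
    laws can be checked coordinatewise.\<close>
  have ext: "f = g" if "f \<in> carrier ?P" "g \<in> carrier ?P" "\<And>k. k < r \<Longrightarrow> f k = g k" for f g
    using that by (auto simp: bimod_power_def intro: PiE_ext)
  have mem: "f k \<in> carrier M" if "f \<in> carrier ?P" "k < r" for f k
    using that by (auto simp: bimod_power_def)
  have closed: "\<zero>\<^bsub>?P\<^esub> \<in> carrier ?P" "f \<oplus>\<^bsub>?P\<^esub> g \<in> carrier ?P"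
    "a \<in> carrier R \<Longrightarrow> lact ?P a f \<in> carrier ?P" "b \<in> carrier S \<Longrightarrow> ract ?P f b \<in> carrier ?P"
    if "f \<in> carrier ?P" "g \<in> carrier ?P" for f g a b
    using that by (auto simp: bimod_power_def lact_closed ract_closed PiE_iff)
  have app: "\<zero>\<^bsub>?P\<^esub> k = \<zero>\<^bsub>M\<^esub>" "(f \<oplus>\<^bsub>?P\<^esub> g) k = f k \<oplus>\<^bsub>M\<^esub> g k"
    "lact ?P a f k = lact M a (f k)" "ract ?P f b k = ract M (f k) b" if "k < r" for f g k a b
    using that by (simp_all add: bimod_power_def)
  have zero: "\<zero>\<^bsub>?P\<^esub> \<in> carrier ?P" by (simp add: bimod_power_def)
  have "abelian_group ?P"
  proof (rule abelian_groupI, goal_cases)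
    case (6 f)
    have "(\<lambda>i\<in>{..<r}. \<ominus>\<^bsub>M\<^esub> f i) \<in> carrier ?P" using mem[OF 6] by (simp add: bimod_power_def)
    with 6 show ?case
      by (intro bexI[of _ "\<lambda>i\<in>{..<r}. \<ominus>\<^bsub>M\<^esub> f i"] ext) (auto simp: app closed zero M.l_neg mem)
  qed (auto intro!: ext simp: app closed zero mem M.a_ac)
  then interpret P: abelian_group ?P .
  show ?thesis
    by unfold_locales (auto intro!: ext simp: app closed mem
          lact_closed ract_closed lact_add_left lact_add_right
          ract_add_left ract_add_right lact_assoc ract_assoc lact_one ract_one lact_ract)
qed

text \<open>The complement is the kernel of the retraction \<open>g\<close>.\<close>

lemma bimod_divides_retract:
  assumes M: "bimodule R S M" and N: "bimodule R S N"
    and f: "f \<in> bimod_hom R S M N" and g: "g \<in> bimod_hom R S N M"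
    and gf: "\<And>x. x \<in> carrier M \<Longrightarrow> g (f x) = x"
  shows "bimod_divides R S M N"
proof -
  interpret M: bimodule R S M by (rule M)
  interpret N: bimodule R S N by (rule N)
  have fh: "f \<in> hom (add_monoid M) (add_monoid N)" and gh: "g \<in> hom (add_monoid N) (add_monoid M)"
    using f g by (auto simp: bimod_hom_def)
  interpret G: group_hom "add_monoid N" "add_monoid M" g
    by (rule add_hom_group_hom[OF gh N.abelian M.abelian])
  define H where "H = kernel (add_monoid N) (add_monoid M) g"
  have H: "x \<in> H \<longleftrightarrow> x \<in> carrier N \<and> g x = \<zero>\<^bsub>M\<^esub>" for x by (auto simp: H_def kernel_def)
  have gl: "g (lact N a x) = lact M a (g x)" if "a \<in> carrier R" "x \<in> carrier N" for a x
    using g that by (auto simp: bimod_hom_def)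
  have gr: "g (ract N x a) = ract M (g x) a" if "a \<in> carrier S" "x \<in> carrier N" for a x
    using g that by (auto simp: bimod_hom_def)
  have fl: "f (lact M a x) = lact N a (f x)" if "a \<in> carrier R" "x \<in> carrier M" for a x
    using f that by (auto simp: bimod_hom_def)
  have fr: "f (ract M x a) = ract N (f x) a" if "a \<in> carrier S" "x \<in> carrier M" for a x
    using f that by (auto simp: bimod_hom_def)
  note cl = add_hom_closed[OF fh] add_hom_closed[OF gh]
  have X: "bimodule R S (N\<lparr>carrier := H\<rparr>)"
    by (rule N.bimodule_carrier_restrict)
      (auto simp: H gl gr N.lact_closed N.ract_closed add_hom_zero[OF M.lact_hom M.abelian M.abelian]
        add_hom_zero[OF M.ract_hom M.abelian M.abelian] H_def[symmetric] intro: G.subgroup_kernel[folded H_def])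
  \<comment> \<open>The second component lies in the kernel of \<open>g\<close> because
    \<open>g (f (g x)) = g x\<close>. The inverse of \<open>h\<close> adds \<open>f\<close> of the
    first component to the second.\<close>
  define h where "h x = (g x, x \<ominus>\<^bsub>N\<^esub> f (g x))" for x
  have "h \<in> iso (add_monoid N) (add_monoid (bimod_sum M (N\<lparr>carrier := H\<rparr>)))"
  proof (rule isoI)
    show "h \<in> hom (add_monoid N) (add_monoid (bimod_sum M (N\<lparr>carrier := H\<rparr>)))"
    proof (rule homI)
      fix x assume "x \<in> carrier (add_monoid N)"
      then show "h x \<in> carrier (add_monoid (bimod_sum M (N\<lparr>carrier := H\<rparr>)))"
        by (auto simp: h_def bimod_sum_def cl H add_hom_diff[OF gh N.abelian M.abelian] gf M.minus_eq M.r_neg)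
    next
      fix x y assume "x \<in> carrier (add_monoid N)" "y \<in> carrier (add_monoid N)"
      then show "h (x \<otimes>\<^bsub>add_monoid N\<^esub> y) = h x \<otimes>\<^bsub>add_monoid (bimod_sum M (N\<lparr>carrier := H\<rparr>))\<^esub> h y"
        by (auto simp: h_def bimod_sum_def cl add_hom_add[OF gh] add_hom_add[OF fh] N.minus_eq N.minus_add N.a_ac)
    qed
    show "bij_betw h (carrier (add_monoid N)) (carrier (add_monoid (bimod_sum M (N\<lparr>carrier := H\<rparr>))))"
    proof (rule bij_betw_byWitness[where f' = "\<lambda>(x, y). f x \<oplus>\<^bsub>N\<^esub> y"])
      show "\<forall>x\<in>carrier (add_monoid N). (case h x of (x, y) \<Rightarrow> f x \<oplus>\<^bsub>N\<^esub> y) = x"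
        by (auto simp: h_def cl N.minus_eq N.a_lcomm[of _ _ "\<ominus>\<^bsub>N\<^esub> _"] N.r_neg)
      show "\<forall>y\<in>carrier (add_monoid (bimod_sum M (N\<lparr>carrier := H\<rparr>))). h (case y of (x, y) \<Rightarrow> f x \<oplus>\<^bsub>N\<^esub> y) = y"
        by (auto simp: h_def cl bimod_sum_def H gf add_hom_add[OF gh] N.minus_eq N.a_assoc N.a_comm[of _ "\<ominus>\<^bsub>N\<^esub> _"] N.r_neg1 N.r_neg2)
      show "h ` carrier (add_monoid N) \<subseteq> carrier (add_monoid (bimod_sum M (N\<lparr>carrier := H\<rparr>)))"
        by (auto simp: h_def bimod_sum_def cl H add_hom_diff[OF gh N.abelian M.abelian] gf M.minus_eq M.r_neg)
      show "(\<lambda>(x, y). f x \<oplus>\<^bsub>N\<^esub> y) ` carrier (add_monoid (bimod_sum M (N\<lparr>carrier := H\<rparr>))) \<subseteq> carrier (add_monoid N)"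
        by (auto simp: bimod_sum_def cl H)
    qed
  qed
  moreover have "h (lact N a x) = lact (bimod_sum M (N\<lparr>carrier := H\<rparr>)) a (h x)"
    if "a \<in> carrier R" "x \<in> carrier N" for a x
    using that by (simp add: h_def bimod_sum_def gl fl cl add_hom_diff[OF N.lact_hom N.abelian N.abelian])
  moreover have "h (ract N x a) = ract (bimod_sum M (N\<lparr>carrier := H\<rparr>)) (h x) a"
    if "a \<in> carrier S" "x \<in> carrier N" for a x
    using that by (simp add: h_def bimod_sum_def gr fr cl add_hom_diff[OF N.ract_hom N.abelian N.abelian])
  ultimately have "bimod_isomorphic R S N (bimod_sum M (N\<lparr>carrier := H\<rparr>))"
    unfolding bimod_isomorphic_def by (intro bexI[of _ h]) auto
  then show ?thesis using X by (auto simp: bimod_divides_def)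
qed

text \<open>A dual-basis criterion: the \<open>f i\<close> are the coordinates of one map into the
  power, the \<open>g i\<close> add up to a map back, and the last hypothesis says that this is a
  retraction. The index set is an arbitrary finite set, which lets summands of different origin be
  indexed by an option type later.\<close>

lemma bimod_divides_powerI:
  assumes M: "bimodule R S M" and N: "bimodule R S N" and I: "finite I"
    and f: "\<And>i. i \<in> I \<Longrightarrow> f i \<in> bimod_hom R S M N" and g: "\<And>i. i \<in> I \<Longrightarrow> g i \<in> bimod_hom R S N M"
    and gf: "\<And>x. x \<in> carrier M \<Longrightarrow> finsum M (\<lambda>i. g i (f i x)) I = x"
  shows "bimod_divides R S M (bimod_power (card I) N)"
proof -
  interpret M: bimodule R S M by (rule M)
  interpret N: bimodule R S N by (rule N)
  let ?P = "bimod_power (card I) N"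
  interpret P: bimodule R S ?P by (rule bimodule_power[OF N])
  \<comment> \<open>\<open>bimod_power\<close> is indexed by an initial segment of the naturals, so
    \<open>I\<close> has to be enumerated.\<close>
  obtain c where c: "bij_betw c {..<card I} I"
    using ex_bij_betw_nat_finite[OF I] by (metis atLeast0LessThan)
  have cI: "c k \<in> I" if "k < card I" for k using c that by (auto simp: bij_betw_def)
  note fD = f[unfolded bimod_hom_def, simplified] and gD = g[unfolded bimod_hom_def, simplified]
  have fh: "f i \<in> hom (add_monoid M) (add_monoid N)" if "i \<in> I" for i using fD[OF that] by auto
  have gh: "g i \<in> hom (add_monoid N) (add_monoid M)" if "i \<in> I" for i using gD[OF that] by auto
  define F where "F x = (\<lambda>k\<in>{..<card I}. f (c k) x)" for x
  define G where "G y = finsum M (\<lambda>k. g (c k) (y k)) {..<card I}" for y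
  have yc: "y k \<in> carrier N" if "y \<in> carrier ?P" "k < card I" for y k
    using that by (auto simp: bimod_power_def)
  have gc: "(\<lambda>k. g (c k) (y k)) \<in> {..<card I} \<rightarrow> carrier M" if "y \<in> carrier ?P" for y
    using yc[OF that] add_hom_closed[OF gh] cI by auto
  have "F \<in> bimod_hom R S M ?P"
  proof (rule bimod_homI)
    show "F \<in> hom (add_monoid M) (add_monoid ?P)"
      using fh cI by (auto simp: hom_def F_def bimod_power_def Pi_def fun_eq_iff)
  qed (use fD cI in \<open>auto simp: F_def bimod_power_def fun_eq_iff\<close>)
  moreover have "G \<in> bimod_hom R S ?P M"
  proof (rule bimod_homI)
    show "G \<in> hom (add_monoid ?P) (add_monoid M)" unfolding G_def
    proof (rule M.add_hom_finsum_pointwise)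
      fix k assume "k \<in> {..<card I}"
      then show "(\<lambda>y. g (c k) (y k)) \<in> hom (add_monoid ?P) (add_monoid M)"
        using add_hom_closed[OF gh[OF cI]] add_hom_add[OF gh[OF cI]]
        by (intro homI) (use \<open>k \<in> {..<card I}\<close> in \<open>auto simp: bimod_power_def PiE_iff\<close>)
    qed
  next
    fix a y assume a: "a \<in> carrier R" and y: "y \<in> carrier ?P"
    have "G (lact ?P a y) = finsum M (\<lambda>k. lact M a (g (c k) (y k))) {..<card I}"
      unfolding G_def
    proof (rule M.finsum_cong')
      fix k assume k: "k \<in> {..<card I}"
      then have "(lact ?P a y) k = lact N a (y k)" by (simp add: bimod_power_def)
      with k show "g (c k) ((lact ?P a y) k) = lact M a (g (c k) (y k))"
        using gD[OF cI] a yc[OF y] by simp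
    qed (use gc[OF y] a in \<open>auto intro!: M.lact_closed\<close>)
    also have "\<dots> = lact M a (G y)"
      unfolding G_def using gc[OF y]
      by (subst add_hom_finsum[OF M.lact_hom[OF a] M.abelian M.abelian]) auto
    finally show "G (lact ?P a y) = lact M a (G y)" .
  next
    fix a y assume a: "a \<in> carrier S" and y: "y \<in> carrier ?P"
    have "G (ract ?P y a) = finsum M (\<lambda>k. ract M (g (c k) (y k)) a) {..<card I}"
      unfolding G_def
    proof (rule M.finsum_cong')
      fix k assume k: "k \<in> {..<card I}"
      then have "(ract ?P y a) k = ract N (y k) a" by (simp add: bimod_power_def)
      with k show "g (c k) ((ract ?P y a) k) = ract M (g (c k) (y k)) a"
        using gD[OF cI] a yc[OF y] by simp
    qed (use gc[OF y] a in \<open>auto intro!: M.ract_closed\<close>)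
    also have "\<dots> = ract M (G y) a"
      unfolding G_def using gc[OF y]
      by (subst add_hom_finsum[OF M.ract_hom[OF a] M.abelian M.abelian]) auto
    finally show "G (ract ?P y a) = ract M (G y) a" .
  qed
  moreover have "G (F x) = x" if x: "x \<in> carrier M" for x
  proof -
    have im: "(\<lambda>i. g i (f i x)) \<in> I \<rightarrow> carrier M"
      using add_hom_closed[OF fh] add_hom_closed[OF gh] x by blast
    have "G (F x) = finsum M (\<lambda>k. g (c k) (f (c k) x)) {..<card I}"
      unfolding G_def F_def using im cI by (intro M.finsum_cong') auto
    also have "\<dots> = finsum M (\<lambda>i. g i (f i x)) I"
      using M.finsum_reindex[of "\<lambda>i. g i (f i x)" c "{..<card I}"] im c by (auto simp: bij_betw_def)
    finally show ?thesis using gf[OF x] by simp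
  qed
  ultimately show ?thesis
    by (rule bimod_divides_retract[OF M P.bimodule_axioms])
qed

text \<open>
  An obstruction to \<open>M | rN\<close>: the retraction \<open>rN \<longrightarrow> M\<close> sends \<open>J n\<close> into \<open>J M\<close>, where \<open>\<beta>\<close> vanishes.
\<close>

lemma not_bimod_divides_power:
  assumes M: "bimodule R S M" and N: "bimodule R S N" and J: "J \<subseteq> carrier R"
    and u: "u \<in> carrier M" and n: "n \<in> carrier N"
    and f: "\<And>f. f \<in> bimod_hom R S M N \<Longrightarrow> \<exists>b\<in>J. f u = lact N b n"
    and \<beta>: "\<beta> \<in> hom (add_monoid M) (add_monoid C)" and C: "abelian_group C"
    and \<beta>J: "\<And>b y. b \<in> J \<Longrightarrow> y \<in> carrier M \<Longrightarrow> \<beta> (lact M b y) = \<zero>\<^bsub>C\<^esub>"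
    and \<beta>u: "\<beta> u \<noteq> \<zero>\<^bsub>C\<^esub>"
  shows "\<not> bimod_divides R S M (bimod_power s N)"
proof
  assume "bimod_divides R S M (bimod_power s N)"
  interpret M: bimodule R S M by (rule M)
  interpret N: bimodule R S N by (rule N)
  interpret C: abelian_group C by (rule C)
  let ?P = "bimod_power s N"
  interpret P: bimodule R S ?P by (rule bimodule_power[OF N])
  obtain X h where X: "bimodule R S (X :: ('a, 'c, nat \<Rightarrow> 'f) bimod)"
    and h: "h \<in> iso (add_monoid ?P) (add_monoid (bimod_sum M X))"
    and hl: "\<And>a x. a \<in> carrier R \<Longrightarrow> x \<in> carrier ?P \<Longrightarrow> h (lact ?P a x) = lact (bimod_sum M X) a (h x)"
    and hr: "\<And>b x. b \<in> carrier S \<Longrightarrow> x \<in> carrier ?P \<Longrightarrow> h (ract ?P x b) = ract (bimod_sum M X) (h x) b"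
    using \<open>bimod_divides R S M (bimod_power s N)\<close> unfolding bimod_divides_def bimod_isomorphic_def by metis
  interpret X: bimodule R S X by (rule X)
  have hb: "bij_betw h (carrier ?P) (carrier M \<times> carrier X)"
    and ha: "\<And>x y. x \<in> carrier ?P \<Longrightarrow> y \<in> carrier ?P \<Longrightarrow> h (x \<oplus>\<^bsub>?P\<^esub> y) = h x \<oplus>\<^bsub>bimod_sum M X\<^esub> h y"
    using h by (auto simp: iso_def hom_def bimod_sum_def)
  \<comment> \<open>\<open>g\<close> is the projection onto the summand \<open>M\<close> and
    \<open>j\<close> below is the matching embedding, so \<open>g (j x) = x\<close>.\<close>
  define g where "g y = fst (h y)" for y
  have hc: "h y \<in> carrier M \<times> carrier X" if "y \<in> carrier ?P" for y
    using hb that by (auto simp: bij_betw_def)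
  have g: "g \<in> hom (add_monoid ?P) (add_monoid M)"
    using hc ha by (intro homI) (auto simp: g_def bimod_sum_def case_prod_unfold mem_Times_iff)
  have gl: "g (lact ?P a x) = lact M a (g x)" if "a \<in> carrier R" "x \<in> carrier ?P" for a x
    using that by (auto simp: g_def hl bimod_sum_def case_prod_unfold)
  define j where "j x = inv_into (carrier ?P) h (x, \<zero>\<^bsub>X\<^esub>)" for x
  have hj: "h (j x) = (x, \<zero>\<^bsub>X\<^esub>)" and jc: "j x \<in> carrier ?P" if "x \<in> carrier M" for x
    using hb that unfolding j_def bij_betw_def
    by (simp_all add: f_inv_into_f inv_into_into)
  have inj: "inj_on h (carrier ?P)" using hb by (auto simp: bij_betw_def)
  have "j \<in> bimod_hom R S M ?P"
  proof (rule bimod_homI)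
    show "j \<in> hom (add_monoid M) (add_monoid ?P)"
    proof (rule homI)
      fix x y assume "x \<in> carrier (add_monoid M)" "y \<in> carrier (add_monoid M)"
      then show "j (x \<otimes>\<^bsub>add_monoid M\<^esub> y) = j x \<otimes>\<^bsub>add_monoid ?P\<^esub> j y"
        using jc hj by (auto intro!: inj_onD[OF inj] simp: ha bimod_sum_def)
    qed (use jc in auto)
    fix a x assume a: "a \<in> carrier R" and x: "x \<in> carrier M"
    show "j (lact M a x) = lact ?P a (j x)"
      using a x jc hj by (auto intro!: inj_onD[OF inj] P.lact_closed
          simp: hl bimod_sum_def M.lact_closed add_hom_zero[OF X.lact_hom X.abelian X.abelian])
  next
    fix a x assume a: "a \<in> carrier S" and x: "x \<in> carrier M"
    show "j (ract M x a) = ract ?P (j x) a"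
      using a x jc hj by (auto intro!: inj_onD[OF inj] P.ract_closed
          simp: hr bimod_sum_def M.ract_closed add_hom_zero[OF X.ract_hom X.abelian X.abelian])
  qed
  \<comment> \<open>Each coordinate of \<open>j\<close> is a homomorphism from \<open>M\<close> to
    \<open>N\<close>, so the hypothesis on such maps gives every coordinate of \<open>j u\<close>
    the form \<open>b k\<close> acting on \<open>n\<close>, with \<open>b k\<close> in
    \<open>J\<close>.\<close>
  then have jk: "(\<lambda>x. j x k) \<in> bimod_hom R S M N" if "k < s" for k
    using that by (auto simp: bimod_hom_def hom_def bimod_power_def)
  obtain b where b: "\<And>k. k < s \<Longrightarrow> b k \<in> J \<and> j u k = lact N (b k) n"
    using f[OF jk] by metis
  \<comment> \<open>\<open>y m\<close> is \<open>j u\<close> cut off after its first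
    \<open>m\<close> coordinates. Consecutive cut-offs differ by \<open>b m\<close> acting on the
    vector with the single entry \<open>n\<close>, which \<open>g\<close> sends into
    \<open>J M\<close>; so \<beta> vanishes along the whole chain, up to
    \<open>y s = j u\<close>.\<close>
  define y where "y m = (\<lambda>k\<in>{..<s}. if k < m then lact N (b k) n else \<zero>\<^bsub>N\<^esub>)" for m
  have bR: "k < s \<Longrightarrow> b k \<in> carrier R" for k using b J by auto
  have yc: "y m \<in> carrier ?P" for m
    by (auto simp: y_def bimod_power_def N.lact_closed bR n)
  have "\<beta> (g (y m)) = \<zero>\<^bsub>C\<^esub>" if "m \<le> s" for m
    using that
  proof (induction m)
    case 0
    have "y 0 = \<zero>\<^bsub>?P\<^esub>" by (simp add: y_def bimod_power_def)
    then show ?case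
      by (simp add: add_hom_zero[OF g P.abelian M.abelian] add_hom_zero[OF \<beta> M.abelian C])
  next
    case (Suc m)
    define d where "d = (\<lambda>k\<in>{..<s}. if k = m then n else \<zero>\<^bsub>N\<^esub>)"
    have d: "d \<in> carrier ?P" by (auto simp: d_def bimod_power_def n)
    have m: "m < s" using Suc by simp
    have "y (Suc m) = y m \<oplus>\<^bsub>?P\<^esub> lact ?P (b m) d"
      using m by (auto simp: y_def d_def bimod_power_def fun_eq_iff N.lact_closed bR n less_Suc_eq
          add_hom_zero[OF N.lact_hom N.abelian N.abelian])
    then have "\<beta> (g (y (Suc m))) = \<beta> (g (y m)) \<oplus>\<^bsub>C\<^esub> \<beta> (lact M (b m) (g d))"
      using yc d m bR by (simp add: add_hom_add[OF g] gl P.lact_closed add_hom_add[OF \<beta>] add_hom_closed[OF g] M.lact_closed)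
    then show ?case using Suc b m d by (simp add: \<beta>J add_hom_closed[OF g])
  qed
  then have "\<beta> (g (y s)) = \<zero>\<^bsub>C\<^esub>" by simp
  moreover have "y s = j u"
    using jc[OF u] b by (auto simp: y_def bimod_power_def fun_eq_iff PiE_def extensional_def)
  moreover have "g (j u) = u" using hj[OF u] by (simp add: g_def)
  ultimately show False using \<beta>u by simp
qed

section \<open>Tensor powers\<close>

lemma (in abelian_group) diff_eq_iff:
  assumes "x \<in> carrier G" "y \<in> carrier G" "z \<in> carrier G"
  shows "x \<ominus> y = z \<longleftrightarrow> x = z \<oplus> y"
  using assms by (auto simp: minus_eq a_assoc l_neg r_neg)

lemma (in abelian_group) diff_add_diff:
  assumes "x \<in> carrier G" "x' \<in> carrier G" "y \<in> carrier G" "y' \<in> carrier G"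
  shows "(x \<oplus> x') \<ominus> (y \<oplus> y') = (x \<ominus> y) \<oplus> (x' \<ominus> y')"
  using assms by (simp add: minus_eq minus_add a_ac)

lemma (in abelian_group) diff_self: "x \<in> carrier G \<Longrightarrow> x \<ominus> x = \<zero>"
  by (simp add: minus_eq r_neg)

lemma (in abelian_group) add_hom_sum:
  assumes f: "f \<in> hom (add_monoid M) (add_monoid G)" and g: "g \<in> hom (add_monoid M) (add_monoid G)"
  shows "(\<lambda>x. f x \<oplus> g x) \<in> hom (add_monoid M) (add_monoid G)"
  using add_hom_closed[OF f] add_hom_closed[OF g] add_hom_add[OF f] add_hom_add[OF g]
  by (intro homI) (simp_all add: a_ac)

lemma free_Abelian_group_hom_add:
  assumes "h \<in> hom (free_Abelian_group S) (add_monoid M)"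
    and "Poly_Mapping.keys f \<subseteq> S" "Poly_Mapping.keys g \<subseteq> S"
  shows "h (f + g) = h f \<oplus>\<^bsub>M\<^esub> h g"
  using assms by (auto simp: hom_def)

lemma free_Abelian_group_hom_diff:
  assumes h: "h \<in> hom (free_Abelian_group S) (add_monoid M)" and M: "abelian_group M"
    and f: "Poly_Mapping.keys f \<subseteq> S" and g: "Poly_Mapping.keys g \<subseteq> S"
  shows "h (f - g) = h f \<ominus>\<^bsub>M\<^esub> h g"
proof -
  have fg: "Poly_Mapping.keys (f - g) \<subseteq> S" using keys_diff[of f g] f g by auto
  have c: "h x \<in> carrier M" if "Poly_Mapping.keys x \<subseteq> S" for x
    using h that by (auto simp: hom_def)
  have "h f = h (f - g) \<oplus>\<^bsub>M\<^esub> h g"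
    using free_Abelian_group_hom_add[OF h fg g] by simp
  then show ?thesis
    using abelian_group.diff_eq_iff[OF M c[OF f] c[OF g] c[OF fg]] by simp
qed

section \<open>The tensor power as a quotient of a free abelian group, and its universal
  property\<close>

locale subring_tensor = ring A for A :: "('a, 'z) ring_scheme" (structure) +
  fixes B
  assumes subring_B: "subring B A"
begin

abbreviation "T \<equiv> tensor_power B A"

abbreviation gens_group ("F") where "gens_group m \<equiv> free_Abelian_group (tensor_gens A m)"

definition coset where "coset m f = tensor_kernel B A m #>\<^bsub>F m\<^esub> f"

text \<open>The pure tensor with the given entries. The number of factors is read off from the list,
  so it need not be carried as an index.\<close>

definition tens where "tens xs = coset (length xs) (frag_of xs)"

lemma B_closed: "b \<in> B \<Longrightarrow> b \<in> carrier A"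
  using subringE(1)[OF subring_B] by auto

lemma tensor_rels_closed: "tensor_rels B A m \<subseteq> carrier (F m)"
proof
  fix f assume "f \<in> tensor_rels B A m"
  then consider us x y vs where "f = frag_of (us @ [x \<oplus> y] @ vs) - frag_of (us @ [x] @ vs) - frag_of (us @ [y] @ vs)"
      "us @ [x] @ vs \<in> tensor_gens A m" "y \<in> carrier A"
    | us x b y vs where "f = frag_of (us @ [x \<otimes> b, y] @ vs) - frag_of (us @ [x, b \<otimes> y] @ vs)"
      "us @ [x, y] @ vs \<in> tensor_gens A m" "b \<in> B"
    unfolding tensor_rels_def by blast
  then show "f \<in> carrier (F m)"
  proof cases
    case 1
    then have "{us @ [x \<oplus> y] @ vs, us @ [x] @ vs, us @ [y] @ vs} \<subseteq> tensor_gens A m"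
      by (auto simp: tensor_gens_def)
    then show ?thesis unfolding 1(1) carrier_free_Abelian_group_iff
      by (intro order.trans[OF keys_diff] Un_least) (auto simp: keys_frag_of)
  next
    case 2
    then have "{us @ [x \<otimes> b, y] @ vs, us @ [x, b \<otimes> y] @ vs} \<subseteq> tensor_gens A m"
      using B_closed by (auto simp: tensor_gens_def)
    then show ?thesis unfolding 2(1) carrier_free_Abelian_group_iff
      by (intro order.trans[OF keys_diff] Un_least) (auto simp: keys_frag_of)
  qed
qed

lemma tensor_kernel_normal: "tensor_kernel B A m \<lhd> F m"
  unfolding tensor_kernel_def
  by (intro comm_group.subgroup_imp_normal abelian_free_Abelian_group
      group.generate_is_subgroup group_free_Abelian_group tensor_rels_closed)

lemma tensor_power_sel:
  "carrier (T m) = carrier (F m Mod tensor_kernel B A m)"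
  "x \<oplus>\<^bsub>T m\<^esub> y = x \<otimes>\<^bsub>F m Mod tensor_kernel B A m\<^esub> y"
  "\<zero>\<^bsub>T m\<^esub> = \<one>\<^bsub>F m Mod tensor_kernel B A m\<^esub>"
  by (simp_all add: tensor_power_def Let_def)

lemma abelian_group_tensor_power: "abelian_group (T m)"
proof -
  interpret Q: comm_group "F m Mod tensor_kernel B A m"
    by (rule comm_group.abelian_FactGroup[OF abelian_free_Abelian_group normal_imp_subgroup[OF tensor_kernel_normal]])
  show ?thesis
  proof (rule abelian_groupI, goal_cases)
    case (6 x)
    then show ?case unfolding tensor_power_sel by (rule Q.l_inv_ex)
  next
    case (4 x y)
    then show ?case unfolding tensor_power_sel by (rule Q.m_comm)
  qed (simp_all only: tensor_power_sel Q.m_closed Q.one_closed Q.m_assoc Q.l_one)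
qed

sublocale T: abelian_group "T m" for m
  by (rule abelian_group_tensor_power)

lemma coset_hom: "coset m \<in> hom (F m) (add_monoid (T m))"
  using normal.r_coset_hom_Mod[OF tensor_kernel_normal, of m]
  by (simp add: hom_def tensor_power_sel coset_def[abs_def] del: mult_FactGroup)

lemma coset_group_hom: "group_hom (F m) (add_monoid (T m)) (coset m)"
  using coset_hom[of m] by (simp add: group_hom_def group_hom_axioms_def T.a_group)

lemma coset_closed: "f \<in> carrier (F m) \<Longrightarrow> coset m f \<in> carrier (T m)"
  using coset_hom[of m] by (auto simp: hom_def)

lemma coset_add:
  "f \<in> carrier (F m) \<Longrightarrow> g \<in> carrier (F m) \<Longrightarrow> coset m (f + g) = coset m f \<oplus>\<^bsub>T m\<^esub> coset m g"
  using free_Abelian_group_hom_add[OF coset_hom] by simp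

lemma coset_diff:
  "f \<in> carrier (F m) \<Longrightarrow> g \<in> carrier (F m) \<Longrightarrow> coset m (f - g) = coset m f \<ominus>\<^bsub>T m\<^esub> coset m g"
  using free_Abelian_group_hom_diff[OF coset_hom abelian_group_tensor_power] by simp

lemma coset_surj: "X \<in> carrier (T m) \<Longrightarrow> \<exists>f \<in> carrier (F m). X = coset m f"
  by (auto simp: tensor_power_def Let_def carrier_FactGroup coset_def)

lemma coset_zero: "coset m 0 = \<zero>\<^bsub>T m\<^esub>"
  using group_hom.hom_one[OF coset_group_hom, of m] by simp

lemma coset_kernel:
  assumes "f \<in> tensor_rels B A m"
  shows "coset m f = \<zero>\<^bsub>T m\<^esub>"
proof -
  have "f \<in> tensor_kernel B A m"
    unfolding tensor_kernel_def using assms by (rule generate.incl)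
  then show ?thesis
    using subgroup.rcos_const[OF normal_imp_subgroup[OF tensor_kernel_normal] group_free_Abelian_group, of f m]
    by (simp add: coset_def tensor_power_def Let_def)
qed

lemma tens_closed: "xs \<in> tensor_gens A m \<Longrightarrow> tens xs \<in> carrier (T m)"
  unfolding tens_def by (auto simp: tensor_gens_def intro!: coset_closed)

lemma tens_coset: "xs \<in> tensor_gens A m \<Longrightarrow> tens xs = coset m (frag_of xs)"
  by (auto simp: tens_def tensor_gens_def)

lemma tens_add:
  assumes "us @ [x] @ vs \<in> tensor_gens A m" "y \<in> carrier A"
  shows "tens (us @ [x \<oplus> y] @ vs) = tens (us @ [x] @ vs) \<oplus>\<^bsub>T m\<^esub> tens (us @ [y] @ vs)"
proof -
  let ?x = "us @ [x] @ vs" and ?y = "us @ [y] @ vs" and ?z = "us @ [x \<oplus> y] @ vs"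
  have g: "?x \<in> tensor_gens A m" "?y \<in> tensor_gens A m" "?z \<in> tensor_gens A m"
    using assms by (auto simp: tensor_gens_def)
  have rel: "frag_of ?z - frag_of ?x - frag_of ?y \<in> tensor_rels B A m"
    using assms unfolding tensor_rels_def by blast
  have "coset m (frag_of ?z) = coset m ((frag_of ?z - frag_of ?x - frag_of ?y) + (frag_of ?x + frag_of ?y))"
    by simp
  also have "\<dots> = coset m (frag_of ?z - frag_of ?x - frag_of ?y) \<oplus>\<^bsub>T m\<^esub> coset m (frag_of ?x + frag_of ?y)"
    by (rule coset_add) (use subsetD[OF tensor_rels_closed rel] g keys_add[of "frag_of ?x" "frag_of ?y"] in \<open>auto simp: keys_frag_of\<close>)
  also have "\<dots> = coset m (frag_of ?x) \<oplus>\<^bsub>T m\<^esub> coset m (frag_of ?y)"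
    using g coset_kernel[OF rel] by (simp add: coset_add coset_closed)
  finally show ?thesis using g by (simp add: tens_coset)
qed

lemma tens_balanced:
  assumes "us @ [x, y] @ vs \<in> tensor_gens A m" "b \<in> B"
  shows "tens (us @ [x \<otimes> b, y] @ vs) = tens (us @ [x, b \<otimes> y] @ vs)"
proof -
  let ?x = "us @ [x \<otimes> b, y] @ vs" and ?y = "us @ [x, b \<otimes> y] @ vs"
  have g: "?x \<in> tensor_gens A m" "?y \<in> tensor_gens A m"
    using assms B_closed by (auto simp: tensor_gens_def)
  have "frag_of ?x - frag_of ?y \<in> tensor_rels B A m"
    using assms unfolding tensor_rels_def by blast
  from coset_kernel[OF this] have "tens ?x \<ominus>\<^bsub>T m\<^esub> tens ?y = \<zero>\<^bsub>T m\<^esub>"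
    using g by (simp add: tens_coset coset_diff)
  then show ?thesis
    using T.diff_eq_iff[of "tens ?x" m "tens ?y" "\<zero>\<^bsub>T m\<^esub>"] g tens_closed by simp
qed

text \<open>The map \<phi> extends to the free abelian group on the lists. The extension kills both
  kinds of relations, hence the subgroup they generate, and so factors through the quotient.\<close>

lemma tensor_universal:
  assumes M: "abelian_group M"
    and closed: "\<And>xs. xs \<in> tensor_gens A m \<Longrightarrow> \<phi> xs \<in> carrier M"
    and add: "\<And>us x y vs. us @ [x] @ vs \<in> tensor_gens A m \<Longrightarrow> y \<in> carrier A
      \<Longrightarrow> \<phi> (us @ [x \<oplus> y] @ vs) = \<phi> (us @ [x] @ vs) \<oplus>\<^bsub>M\<^esub> \<phi> (us @ [y] @ vs)"
    and balanced: "\<And>us x b y vs. us @ [x, y] @ vs \<in> tensor_gens A m \<Longrightarrow> b \<in> B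
      \<Longrightarrow> \<phi> (us @ [x \<otimes> b, y] @ vs) = \<phi> (us @ [x, b \<otimes> y] @ vs)"
  shows "\<exists>h \<in> hom (add_monoid (T m)) (add_monoid M). \<forall>xs \<in> tensor_gens A m. h (tens xs) = \<phi> xs"
proof -
  interpret M: abelian_group M by (rule M)
  obtain h0 where h0: "h0 \<in> hom (F m) (add_monoid M)"
    and h0_of: "\<And>xs. xs \<in> tensor_gens A m \<Longrightarrow> h0 (frag_of xs) = \<phi> xs"
    using comm_group.free_Abelian_group_universal[OF M.a_comm_group, of \<phi> "tensor_gens A m"] closed
    by (metis (no_types, lifting) image_subsetI partial_object.select_convs(1))
  interpret h0: group_hom "F m" "add_monoid M" h0
    using h0 by (simp add: group_hom_def group_hom_axioms_def M.a_group)
  note diff = free_Abelian_group_hom_diff[OF h0 M]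
  have "h0 f = \<zero>\<^bsub>M\<^esub>" if "f \<in> tensor_rels B A m" for f
  proof -
    from that consider us x y vs where "f = frag_of (us @ [x \<oplus> y] @ vs) - frag_of (us @ [x] @ vs) - frag_of (us @ [y] @ vs)"
      "us @ [x] @ vs \<in> tensor_gens A m" "y \<in> carrier A"
    | us x b y vs where "f = frag_of (us @ [x \<otimes> b, y] @ vs) - frag_of (us @ [x, b \<otimes> y] @ vs)"
      "us @ [x, y] @ vs \<in> tensor_gens A m" "b \<in> B"
      unfolding tensor_rels_def by blast
    then show ?thesis
    proof cases
      case 1
      let ?x = "us @ [x] @ vs" and ?y = "us @ [y] @ vs" and ?z = "us @ [x \<oplus> y] @ vs"
      have g: "?x \<in> tensor_gens A m" "?y \<in> tensor_gens A m" "?z \<in> tensor_gens A m"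
        using 1 by (auto simp: tensor_gens_def)
      have "h0 f = \<phi> ?z \<ominus>\<^bsub>M\<^esub> \<phi> ?x \<ominus>\<^bsub>M\<^esub> \<phi> ?y"
        unfolding 1(1) using g diff[of "frag_of ?z - frag_of ?x" "frag_of ?y"] diff[of "frag_of ?z" "frag_of ?x"]
          keys_diff[of "frag_of ?z" "frag_of ?x"] h0_of[OF g(1)] h0_of[OF g(2)] h0_of[OF g(3)]
        by (auto simp: keys_frag_of)
      also have "\<phi> ?z \<ominus>\<^bsub>M\<^esub> \<phi> ?x = \<phi> ?y"
        using add[OF 1(2,3)] closed[OF g(1)] closed[OF g(2)] closed[OF g(3)]
        by (simp add: M.diff_eq_iff M.a_comm)
      also have "\<phi> ?y \<ominus>\<^bsub>M\<^esub> \<phi> ?y = \<zero>\<^bsub>M\<^esub>" using closed[OF g(2)] by (simp add: M.diff_eq_iff)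
      finally show ?thesis .
    next
      case 2
      then have g: "us @ [x \<otimes> b, y] @ vs \<in> tensor_gens A m" "us @ [x, b \<otimes> y] @ vs \<in> tensor_gens A m"
        using B_closed by (auto simp: tensor_gens_def)
      then show ?thesis
        unfolding 2(1) using diff h0_of[OF g(1)] h0_of[OF g(2)] balanced[OF 2(2,3)] closed[OF g(2)]
        by (simp add: M.diff_eq_iff keys_frag_of)
    qed
  qed
  then have "tensor_rels B A m \<subseteq> kernel (F m) (add_monoid M) h0"
    using subsetD[OF tensor_rels_closed] by (auto simp: kernel_def simp del: carrier_free_Abelian_group_iff)
  then have "tensor_kernel B A m \<subseteq> kernel (F m) (add_monoid M) h0"
    unfolding tensor_kernel_def
    by (intro group.generate_subgroup_incl group_free_Abelian_group h0.subgroup_kernel)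
  from h0.FactGroup_universal_kernel[OF tensor_kernel_normal this]
  obtain h where h: "h \<in> hom (F m Mod tensor_kernel B A m) (add_monoid M)"
    "\<And>f. f \<in> carrier (F m) \<Longrightarrow> h (tensor_kernel B A m #>\<^bsub>F m\<^esub> f) = h0 f" by metis
  have "h (tens xs) = \<phi> xs" if "xs \<in> tensor_gens A m" for xs
    using h(2)[of "frag_of xs"] that h0_of by (simp add: tens_coset coset_def)
  with h(1) show ?thesis by (auto simp: hom_def tensor_power_sel simp del: mult_FactGroup)
qed

text \<open>Elements are integer combinations of pure tensors. Closure under differences covers sums
  and negatives at once, as in the induction principle for free abelian groups.\<close>

lemma tensor_induct [consumes 1, case_names zero tens diff]:
  assumes "X \<in> carrier (T m)"
    and "P \<zero>\<^bsub>T m\<^esub>"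
    and "\<And>xs. xs \<in> tensor_gens A m \<Longrightarrow> P (tens xs)"
    and "\<And>X Y. X \<in> carrier (T m) \<Longrightarrow> Y \<in> carrier (T m) \<Longrightarrow> P X \<Longrightarrow> P Y \<Longrightarrow> P (X \<ominus>\<^bsub>T m\<^esub> Y)"
  shows "P X"
proof -
  obtain f where f: "Poly_Mapping.keys f \<subseteq> tensor_gens A m" and X: "X = coset m f"
    using coset_surj[OF assms(1)] by auto
  from f have "P (coset m f)"
  proof (rule free_Abelian_group_induct)
    show "P (coset m 0)" using assms(2) by (simp add: coset_zero)
    show "P (coset m (frag_of xs))" if "xs \<in> tensor_gens A m" for xs
      using assms(3)[OF that] that by (simp add: tens_coset)
    show "P (coset m (f - g))" if "Poly_Mapping.keys f \<subseteq> tensor_gens A m" "Poly_Mapping.keys g \<subseteq> tensor_gens A m"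
        "P (coset m f)" "P (coset m g)" for f g
      using that assms(4) by (simp add: coset_diff coset_closed)
  qed
  with X show ?thesis by simp
qed

text \<open>The uniqueness half of the universal property; identities between additive maps on
  \<open>T m\<close> are reduced to pure tensors with it.\<close>

lemma tensor_hom_eqI:
  assumes h: "h \<in> hom (add_monoid (T m)) (add_monoid M)" and k: "k \<in> hom (add_monoid (T m)) (add_monoid M)"
    and M: "abelian_group M" and X: "X \<in> carrier (T m)"
    and eq: "\<And>xs. xs \<in> tensor_gens A m \<Longrightarrow> h (tens xs) = k (tens xs)"
  shows "h X = k X"
  using X
proof (induction X rule: tensor_induct)
  case zero
  then show ?case using add_hom_zero[OF h _ M] add_hom_zero[OF k _ M] abelian_group_tensor_power by simp
next
  case (diff X Y)
  then show ?case
    using add_hom_diff[OF h abelian_group_tensor_power M] add_hom_diff[OF k abelian_group_tensor_power M] by simp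
qed (rule eq)

section \<open>The two actions on the tensor power\<close>

text \<open>
  The actions of \<open>tensor_power\<close> are unions over all representatives of a coset; this is the common
  well-definedness argument.
\<close>

lemma coset_extension_hom:
  assumes closed: "\<And>xs. xs \<in> tensor_gens A m \<Longrightarrow> \<psi> xs \<in> tensor_gens A m"
    and add: "\<And>us x y vs. us @ [x] @ vs \<in> tensor_gens A m \<Longrightarrow> y \<in> carrier A
      \<Longrightarrow> tens (\<psi> (us @ [x \<oplus> y] @ vs)) = tens (\<psi> (us @ [x] @ vs)) \<oplus>\<^bsub>T m\<^esub> tens (\<psi> (us @ [y] @ vs))"
    and balanced: "\<And>us x b y vs. us @ [x, y] @ vs \<in> tensor_gens A m \<Longrightarrow> b \<in> B
      \<Longrightarrow> tens (\<psi> (us @ [x \<otimes> b, y] @ vs)) = tens (\<psi> (us @ [x, b \<otimes> y] @ vs))"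
  defines "\<Phi> \<equiv> \<lambda>X. \<Union>f\<in>X. tensor_kernel B A m #>\<^bsub>F m\<^esub> frag_extend (\<lambda>xs. frag_of (\<psi> xs)) f"
  shows "\<Phi> \<in> hom (add_monoid (T m)) (add_monoid (T m))"
    and "\<And>xs. xs \<in> tensor_gens A m \<Longrightarrow> \<Phi> (tens xs) = tens (\<psi> xs)"
proof -
  obtain h where h: "h \<in> hom (add_monoid (T m)) (add_monoid (T m))"
    and ht: "\<And>xs. xs \<in> tensor_gens A m \<Longrightarrow> h (tens xs) = tens (\<psi> xs)"
    using tensor_universal[OF abelian_group_tensor_power, of m "\<lambda>xs. tens (\<psi> xs)" m] add balanced
      tens_closed[OF closed] by auto
  let ?e = "frag_extend (\<lambda>xs. frag_of (\<psi> xs))"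
  \<comment> \<open>On representatives, the extension \<open>?e\<close> of \<psi> lifts the map
    \<open>h\<close> given by the universal property.\<close>
  have e: "?e f \<in> carrier (F m) \<and> coset m (?e f) = h (coset m f)" if "f \<in> carrier (F m)" for f
    using that[unfolded carrier_free_Abelian_group_iff]
  proof (rule free_Abelian_group_induct[where P = "\<lambda>f. ?e f \<in> carrier (F m) \<and> coset m (?e f) = h (coset m f)"])
    show "?e 0 \<in> carrier (F m) \<and> coset m (?e 0) = h (coset m 0)"
      using add_hom_zero[OF h abelian_group_tensor_power abelian_group_tensor_power]
      by (simp add: coset_zero)
  next
    fix f g
    assume fg: "Poly_Mapping.keys f \<subseteq> tensor_gens A m" "Poly_Mapping.keys g \<subseteq> tensor_gens A m"
      "?e f \<in> carrier (F m) \<and> coset m (?e f) = h (coset m f)"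
      "?e g \<in> carrier (F m) \<and> coset m (?e g) = h (coset m g)"
    then have "Poly_Mapping.keys (?e f - ?e g) \<subseteq> tensor_gens A m"
      using keys_diff[of "?e f" "?e g"] by auto
    with fg show "?e (f - g) \<in> carrier (F m) \<and> coset m (?e (f - g)) = h (coset m (f - g))"
      using add_hom_diff[OF h abelian_group_tensor_power abelian_group_tensor_power]
      by (simp add: frag_extend_diff coset_diff coset_closed)
  next
    fix xs assume xs: "xs \<in> tensor_gens A m"
    then show "?e (frag_of xs) \<in> carrier (F m) \<and> coset m (?e (frag_of xs)) = h (coset m (frag_of xs))"
      using closed[OF xs] ht[OF xs] by (simp add: tens_coset)
  qed
  \<comment> \<open>All representatives \<open>g\<close> of \<open>X\<close> give the same coset of
    \<open>?e g\<close>, namely \<open>h X\<close>. As \<open>X\<close> is nonempty, the union over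
    its representatives is that single coset.\<close>
  have eq: "\<Phi> X = h X" if "X \<in> carrier (T m)" for X
  proof -
    obtain f where f: "f \<in> carrier (F m)" "X = coset m f" using coset_surj[OF \<open>X \<in> carrier (T m)\<close>] by blast
    have sub: "subgroup (tensor_kernel B A m) (F m)" by (rule normal_imp_subgroup[OF tensor_kernel_normal])
    have "f \<in> X" using group.rcos_self[OF group_free_Abelian_group f(1) sub] f(2) by (simp add: coset_def)
    moreover have "coset m (?e g) = h X" if "g \<in> X" for g
    proof -
      have "coset m g = X"
        using group.repr_independence[OF group_free_Abelian_group, where y = g and x = f] that f sub
        by (simp add: coset_def)
      moreover have "g \<in> carrier (F m)"
        using that f subgroup.elemrcos_carrier[OF sub group_free_Abelian_group] by (metis coset_def)
      ultimately show ?thesis using e by simp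
    qed
    ultimately show ?thesis unfolding \<Phi>_def coset_def by auto
  qed
  show "\<Phi> \<in> hom (add_monoid (T m)) (add_monoid (T m))"
    using h eq T.add.m_closed by (auto simp: hom_def)
  show "\<Phi> (tens xs) = tens (\<psi> xs)" if "xs \<in> tensor_gens A m" for xs
    using that by (simp add: eq ht tens_closed)
qed

text \<open>An action changes only an end factor, which exists because \<open>m \<ge> 1\<close>. If
  a relation involves this factor, distributivity or associativity in \<open>A\<close> turns its
  image into a relation again; otherwise the same relation recurs with another end entry. These are
  the cases on \<open>us\<close> and on \<open>vs\<close>.\<close>

lemma
  assumes a: "a \<in> carrier A" and m: "m \<ge> 1"
  shows lact_tensor_hom: "lact (T m) a \<in> hom (add_monoid (T m)) (add_monoid (T m))"
    and lact_tens: "\<And>xs. xs \<in> tensor_gens A m \<Longrightarrow> lact (T m) a (tens xs) = tens ((a \<otimes> hd xs) # tl xs)"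
    and ract_tensor_hom: "(\<lambda>X. ract (T m) X a) \<in> hom (add_monoid (T m)) (add_monoid (T m))"
    and ract_tens: "\<And>xs. xs \<in> tensor_gens A m \<Longrightarrow> ract (T m) (tens xs) a = tens (butlast xs @ [last xs \<otimes> a])"
proof -
  let ?l = "\<lambda>xs. (a \<otimes> hd xs) # tl xs" and ?r = "\<lambda>xs. butlast xs @ [last xs \<otimes> a]"
  have l: "?l xs \<in> tensor_gens A m" and r: "?r xs \<in> tensor_gens A m" if "xs \<in> tensor_gens A m" for xs
  proof -
    have "xs \<noteq> []" using that m by (auto simp: tensor_gens_def)
    then have "last xs \<in> carrier A" using last_in_set that by (auto simp: tensor_gens_def)
    with \<open>xs \<noteq> []\<close> that show "?l xs \<in> tensor_gens A m" "?r xs \<in> tensor_gens A m" using a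
      by (auto simp: tensor_gens_def dest: in_set_butlastD list.set_sel(2) intro: list.set_sel(1))
  qed
  have l_add: "tens (?l (us @ [x \<oplus> y] @ vs)) = tens (?l (us @ [x] @ vs)) \<oplus>\<^bsub>T m\<^esub> tens (?l (us @ [y] @ vs))"
    if "us @ [x] @ vs \<in> tensor_gens A m" "y \<in> carrier A" for us x y vs
    using l[OF that(1)] that(2) tens_add[of "[]" "a \<otimes> x" vs m "a \<otimes> y"] tens_add[of "?l us" x vs m y] a that(1)
    by (cases us) (auto simp: r_distr tensor_gens_def)
  have l_balanced: "tens (?l (us @ [x \<otimes> b, y] @ vs)) = tens (?l (us @ [x, b \<otimes> y] @ vs))"
    if "us @ [x, y] @ vs \<in> tensor_gens A m" "b \<in> B" for us x b y vs
    using l[OF that(1)] that(2) tens_balanced[of "[]" "a \<otimes> x" y vs m b] tens_balanced[of "?l us" x y vs m b] a that(1) B_closed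
    by (cases us) (auto simp: m_assoc tensor_gens_def)
  have r_add: "tens (?r (us @ [x \<oplus> y] @ vs)) = tens (?r (us @ [x] @ vs)) \<oplus>\<^bsub>T m\<^esub> tens (?r (us @ [y] @ vs))"
    if "us @ [x] @ vs \<in> tensor_gens A m" "y \<in> carrier A" for us x y vs
    using r[OF that(1)] that(2) tens_add[of us "x \<otimes> a" "[]" m "y \<otimes> a"] tens_add[of us x "?r vs" m y] a that(1)
    by (cases vs) (auto simp: l_distr tensor_gens_def butlast_append)
  have r_balanced: "tens (?r (us @ [x \<otimes> b, y] @ vs)) = tens (?r (us @ [x, b \<otimes> y] @ vs))"
    if "us @ [x, y] @ vs \<in> tensor_gens A m" "b \<in> B" for us x b y vs
    using r[OF that(1)] that(2) tens_balanced[of us x "y \<otimes> a" "[]" m b] tens_balanced[of us x y "?r vs" m b] a that(1) B_closed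
    by (cases vs) (auto simp: m_assoc tensor_gens_def butlast_append)
  have lact: "lact (T m) a = (\<lambda>X. \<Union>f\<in>X. tensor_kernel B A m #>\<^bsub>F m\<^esub> frag_extend (\<lambda>xs. frag_of (?l xs)) f)"
    and ract: "(\<lambda>X. ract (T m) X a) = (\<lambda>X. \<Union>f\<in>X. tensor_kernel B A m #>\<^bsub>F m\<^esub> frag_extend (\<lambda>xs. frag_of (?r xs)) f)"
    by (simp_all add: tensor_power_def Let_def)
  show "lact (T m) a \<in> hom (add_monoid (T m)) (add_monoid (T m))"
    unfolding lact by (rule coset_extension_hom(1)) (use l l_add l_balanced in auto)
  show "lact (T m) a (tens xs) = tens (?l xs)" if "xs \<in> tensor_gens A m" for xs
    unfolding lact by (rule coset_extension_hom(2)) (use l l_add l_balanced that in auto)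
  show "(\<lambda>X. ract (T m) X a) \<in> hom (add_monoid (T m)) (add_monoid (T m))"
    unfolding ract by (rule coset_extension_hom(1)) (use r r_add r_balanced in auto)
  show "ract (T m) (tens xs) a = tens (?r xs)" if "xs \<in> tensor_gens A m" for xs
    using coset_extension_hom(2)[of m ?r xs] r r_add r_balanced that fun_cong[OF ract, of "tens xs"] by simp
qed

lemma tensor_gens_cases:
  assumes "xs \<in> tensor_gens A m" "m \<ge> 1"
  obtains x ys where "xs = x # ys" "x \<in> carrier A" "set ys \<subseteq> carrier A" "m = Suc (length ys)"
  using assms by (cases xs) (auto simp: tensor_gens_def)

lemma tensor_gens_cases_last:
  assumes "xs \<in> tensor_gens A m" "m \<ge> 1"
  obtains x ys where "xs = ys @ [x]" "x \<in> carrier A" "set ys \<subseteq> carrier A" "m = Suc (length ys)"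
  using assms by (cases xs rule: rev_cases) (auto simp: tensor_gens_def)

text \<open>The laws beyond closure and additivity in \<open>X\<close> equate two maps that are
  additive in \<open>X\<close>, so \<open>tensor_hom_eqI\<close> leaves only pure tensors to
  check.\<close>

lemma bimodule_tensor_power:
  assumes m: "m \<ge> 1"
  shows "bimodule A A (T m)"
proof -
  note L = lact_tensor_hom[OF _ m] and R = ract_tensor_hom[OF _ m]
  note Lt = lact_tens[OF _ m] and Rt = ract_tens[OF _ m]
  note eqI = tensor_hom_eqI[OF _ _ abelian_group_tensor_power]
  have comp: "(\<lambda>X. f (g X)) \<in> hom (add_monoid (T m)) (add_monoid (T m))"
    if "f \<in> hom (add_monoid (T m)) (add_monoid (T m))" "g \<in> hom (add_monoid (T m)) (add_monoid (T m))" for f g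
    using that by (auto simp: hom_def Pi_def)
  show ?thesis
  proof unfold_locales
    fix a X assume "a \<in> carrier A" "X \<in> carrier (T m)"
    then show "lact (T m) a X \<in> carrier (T m)" "ract (T m) X a \<in> carrier (T m)"
      using add_hom_closed[OF L] add_hom_closed[OF R] by auto
  next
    fix a X Y assume "a \<in> carrier A" "X \<in> carrier (T m)" "Y \<in> carrier (T m)"
    then show "lact (T m) a (X \<oplus>\<^bsub>T m\<^esub> Y) = lact (T m) a X \<oplus>\<^bsub>T m\<^esub> lact (T m) a Y"
      "ract (T m) (X \<oplus>\<^bsub>T m\<^esub> Y) a = ract (T m) X a \<oplus>\<^bsub>T m\<^esub> ract (T m) Y a"
      using add_hom_add[OF L] add_hom_add[OF R] by auto
  next
    fix a a' X assume a: "a \<in> carrier A" "a' \<in> carrier A" and X: "X \<in> carrier (T m)"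
    show "lact (T m) (a \<oplus> a') X = lact (T m) a X \<oplus>\<^bsub>T m\<^esub> lact (T m) a' X"
    proof (rule eqI[OF L T.add_hom_sum[OF L L] X])
      fix xs assume xs: "xs \<in> tensor_gens A m"
      then obtain x ys where "xs = x # ys" "x \<in> carrier A" "set ys \<subseteq> carrier A" "m = Suc (length ys)"
        using m by (rule tensor_gens_cases)
      then show "lact (T m) (a \<oplus> a') (tens xs) = lact (T m) a (tens xs) \<oplus>\<^bsub>T m\<^esub> lact (T m) a' (tens xs)"
        using xs a Lt tens_add[of "[]" "a \<otimes> x" ys m "a' \<otimes> x"] by (simp add: l_distr tensor_gens_def)
    qed (use a in auto)
    show "ract (T m) X (a \<oplus> a') = ract (T m) X a \<oplus>\<^bsub>T m\<^esub> ract (T m) X a'"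
    proof (rule eqI[OF R T.add_hom_sum[OF R R] X])
      fix xs assume xs: "xs \<in> tensor_gens A m"
      then obtain x ys where "xs = ys @ [x]" "x \<in> carrier A" "set ys \<subseteq> carrier A" "m = Suc (length ys)"
        using m by (rule tensor_gens_cases_last)
      then show "ract (T m) (tens xs) (a \<oplus> a') = ract (T m) (tens xs) a \<oplus>\<^bsub>T m\<^esub> ract (T m) (tens xs) a'"
        using xs a Rt tens_add[of ys "x \<otimes> a" "[]" m "x \<otimes> a'"] by (simp add: r_distr tensor_gens_def)
    qed (use a in auto)
    show "lact (T m) (a \<otimes> a') X = lact (T m) a (lact (T m) a' X)"
    proof (rule eqI[OF L comp[OF L L] X])
      fix xs assume xs: "xs \<in> tensor_gens A m"
      then obtain x ys where "xs = x # ys" "x \<in> carrier A" "set ys \<subseteq> carrier A" "m = Suc (length ys)"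
        using m by (rule tensor_gens_cases)
      then show "lact (T m) (a \<otimes> a') (tens xs) = lact (T m) a (lact (T m) a' (tens xs))"
        using xs a Lt by (simp add: m_assoc tensor_gens_def)
    qed (use a in auto)
    show "ract (T m) X (a \<otimes> a') = ract (T m) (ract (T m) X a) a'"
    proof (rule eqI[OF R comp[OF R R] X])
      fix xs assume xs: "xs \<in> tensor_gens A m"
      then obtain x ys where "xs = ys @ [x]" "x \<in> carrier A" "set ys \<subseteq> carrier A" "m = Suc (length ys)"
        using m by (rule tensor_gens_cases_last)
      then show "ract (T m) (tens xs) (a \<otimes> a') = ract (T m) (ract (T m) (tens xs) a) a'"
        using xs a Rt by (simp add: m_assoc tensor_gens_def)
    qed (use a in auto)
  next
    fix X assume X: "X \<in> carrier (T m)"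
    have id: "(\<lambda>X. X) \<in> hom (add_monoid (T m)) (add_monoid (T m))" by (auto simp: hom_def)
    show "lact (T m) \<one> X = X"
    proof (rule eqI[OF L id X])
      fix xs assume xs: "xs \<in> tensor_gens A m"
      then obtain x ys where "xs = x # ys" "x \<in> carrier A"
        using m by (rule tensor_gens_cases)
      then show "lact (T m) \<one> (tens xs) = tens xs" using xs Lt by simp
    qed simp
    show "ract (T m) X \<one> = X"
    proof (rule eqI[OF R id X])
      fix xs assume xs: "xs \<in> tensor_gens A m"
      then obtain x ys where "xs = ys @ [x]" "x \<in> carrier A"
        using m by (rule tensor_gens_cases_last)
      then show "ract (T m) (tens xs) \<one> = tens xs" using xs Rt by simp
    qed simp
  next
    fix a X b assume a: "a \<in> carrier A" and X: "X \<in> carrier (T m)" and b: "b \<in> carrier A"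
    show "ract (T m) (lact (T m) a X) b = lact (T m) a (ract (T m) X b)"
    proof (rule eqI[OF comp[OF R L] comp[OF L R] X])
      fix xs assume xs: "xs \<in> tensor_gens A m"
      then obtain x ys where xs': "xs = x # ys" "x \<in> carrier A" "set ys \<subseteq> carrier A" "m = Suc (length ys)"
        using m by (rule tensor_gens_cases)
      show "ract (T m) (lact (T m) a (tens xs)) b = lact (T m) a (ract (T m) (tens xs) b)"
      \<comment> \<open>With a single factor both actions hit the same entry and associativity is
        needed; with more factors they change different entries.\<close>
      proof (cases ys rule: rev_cases)
        case Nil
        then show ?thesis using xs xs' a b Lt Rt by (simp add: m_assoc tensor_gens_def)
      next
        case (snoc zs z)
        then show ?thesis using xs xs' a b Lt Rt by (simp add: tensor_gens_def butlast_append)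
      qed
    qed (use a b in auto)
  qed
qed

text \<open>Both sides of each equivariance law are additive, so pure tensors suffice. Keeping
  \<open>R\<close> and \<open>S\<close> apart from \<open>A\<close> allows one side, or both, to be
  \<open>B\<close>.\<close>

lemma tensor_bimod_homI:
  assumes h: "h \<in> hom (add_monoid (T m)) (add_monoid M)" and M: "bimodule R S M" and m: "m \<ge> 1"
    and RS: "carrier R \<subseteq> carrier A" "carrier S \<subseteq> carrier A"
    and l: "\<And>a xs. a \<in> carrier R \<Longrightarrow> xs \<in> tensor_gens A m
      \<Longrightarrow> h (tens ((a \<otimes> hd xs) # tl xs)) = lact M a (h (tens xs))"
    and r: "\<And>b xs. b \<in> carrier S \<Longrightarrow> xs \<in> tensor_gens A m
      \<Longrightarrow> h (tens (butlast xs @ [last xs \<otimes> b])) = ract M (h (tens xs)) b"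
  shows "h \<in> bimod_hom R S (T m) M"
proof -
  interpret M: bimodule R S M by (rule M)
  show ?thesis
  proof (rule bimod_homI[OF h])
    fix a X assume a: "a \<in> carrier R" and X: "X \<in> carrier (T m)"
    then have "a \<in> carrier A" using RS by auto
    from a lact_tens[OF this m] show "h (lact (T m) a X) = lact M a (h X)"
      by (intro tensor_hom_eqI[OF _ _ M.abelian X, where h = "\<lambda>X. h (lact (T m) a X)"]
          hom_compose[OF lact_tensor_hom[OF \<open>a \<in> carrier A\<close> m] h, unfolded comp_def]
          hom_compose[OF h M.lact_hom[OF a], unfolded comp_def])
        (simp_all add: l)
  next
    fix a X assume a: "a \<in> carrier S" and X: "X \<in> carrier (T m)"
    then have "a \<in> carrier A" using RS by auto
    from a ract_tens[OF this m] show "h (ract (T m) X a) = ract M (h X) a"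
      by (intro tensor_hom_eqI[OF _ _ M.abelian X, where h = "\<lambda>X. h (ract (T m) X a)"]
          hom_compose[OF ract_tensor_hom[OF \<open>a \<in> carrier A\<close> m] h, unfolded comp_def]
          hom_compose[OF h M.ract_hom[OF a], unfolded comp_def])
        (simp_all add: r)
  qed
qed

section \<open>Tensor powers with one, two and three factors\<close>

lemma tensor_gens_1: "xs \<in> tensor_gens A 1 \<longleftrightarrow> (\<exists>a \<in> carrier A. xs = [a])"
  by (auto simp: tensor_gens_def length_Suc_conv)

lemma tensor_gens_2: "xs \<in> tensor_gens A 2 \<longleftrightarrow> (\<exists>a \<in> carrier A. \<exists>b \<in> carrier A. xs = [a, b])"
  by (auto simp: tensor_gens_def length_Suc_conv numeral_2_eq_2)

lemma tensor_gens_3: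
  "xs \<in> tensor_gens A 3 \<longleftrightarrow> (\<exists>a \<in> carrier A. \<exists>b \<in> carrier A. \<exists>c \<in> carrier A. xs = [a, b, c])"
  by (auto simp: tensor_gens_def length_Suc_conv numeral_3_eq_3)

text \<open>With one factor there are no neighbouring entries, so additivity is the only condition.
  The versions for two and three factors below likewise replace lists by separate arguments.\<close>

lemma tensor_1_universal:
  assumes M: "abelian_group M" and \<phi>: "\<phi> \<in> hom (add_monoid A) (add_monoid M)"
  shows "\<exists>h \<in> hom (add_monoid (T 1)) (add_monoid M). \<forall>a \<in> carrier A. h (tens [a]) = \<phi> a"
proof -
  have "\<exists>h \<in> hom (add_monoid (T 1)) (add_monoid M). \<forall>xs \<in> tensor_gens A 1. h (tens xs) = \<phi> (hd xs)"
    by (rule tensor_universal[OF M])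
      (auto simp: tensor_gens_1 Cons_eq_append_conv append_eq_Cons_conv add_hom_add[OF \<phi>] add_hom_closed[OF \<phi>] simp del: One_nat_def)
  then show ?thesis by (elim bexE, intro bexI) (simp_all add: tensor_gens_1 del: One_nat_def)
qed

lemma tensor_2_universal:
  assumes M: "abelian_group M"
    and closed: "\<And>a b. \<lbrakk>a \<in> carrier A; b \<in> carrier A\<rbrakk> \<Longrightarrow> \<phi> a b \<in> carrier M"
    and add_l: "\<And>a a' b. \<lbrakk>a \<in> carrier A; a' \<in> carrier A; b \<in> carrier A\<rbrakk> \<Longrightarrow> \<phi> (a \<oplus> a') b = \<phi> a b \<oplus>\<^bsub>M\<^esub> \<phi> a' b"
    and add_r: "\<And>a b b'. \<lbrakk>a \<in> carrier A; b \<in> carrier A; b' \<in> carrier A\<rbrakk> \<Longrightarrow> \<phi> a (b \<oplus> b') = \<phi> a b \<oplus>\<^bsub>M\<^esub> \<phi> a b'"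
    and balanced: "\<And>a x b. \<lbrakk>a \<in> carrier A; x \<in> B; b \<in> carrier A\<rbrakk> \<Longrightarrow> \<phi> (a \<otimes> x) b = \<phi> a (x \<otimes> b)"
  shows "\<exists>h \<in> hom (add_monoid (T 2)) (add_monoid M). \<forall>a \<in> carrier A. \<forall>b \<in> carrier A. h (tens [a, b]) = \<phi> a b"
proof -
  have "\<exists>h \<in> hom (add_monoid (T 2)) (add_monoid M). \<forall>xs \<in> tensor_gens A 2. h (tens xs) = \<phi> (xs ! 0) (xs ! 1)"
    by (rule tensor_universal[OF M])
      (auto simp: tensor_gens_2 Cons_eq_append_conv append_eq_Cons_conv closed add_l add_r balanced)
  then show ?thesis by (elim bexE, intro bexI) (simp_all add: tensor_gens_2)
qed

lemma tensor_3_universal: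
  assumes M: "abelian_group M"
    and closed: "\<And>a b c. \<lbrakk>a \<in> carrier A; b \<in> carrier A; c \<in> carrier A\<rbrakk> \<Longrightarrow> \<phi> a b c \<in> carrier M"
    and add_1: "\<And>a a' b c. \<lbrakk>a \<in> carrier A; a' \<in> carrier A; b \<in> carrier A; c \<in> carrier A\<rbrakk>
      \<Longrightarrow> \<phi> (a \<oplus> a') b c = \<phi> a b c \<oplus>\<^bsub>M\<^esub> \<phi> a' b c"
    and add_2: "\<And>a b b' c. \<lbrakk>a \<in> carrier A; b \<in> carrier A; b' \<in> carrier A; c \<in> carrier A\<rbrakk>
      \<Longrightarrow> \<phi> a (b \<oplus> b') c = \<phi> a b c \<oplus>\<^bsub>M\<^esub> \<phi> a b' c"
    and add_3: "\<And>a b c c'. \<lbrakk>a \<in> carrier A; b \<in> carrier A; c \<in> carrier A; c' \<in> carrier A\<rbrakk>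
      \<Longrightarrow> \<phi> a b (c \<oplus> c') = \<phi> a b c \<oplus>\<^bsub>M\<^esub> \<phi> a b c'"
    and balanced_1: "\<And>a x b c. \<lbrakk>a \<in> carrier A; x \<in> B; b \<in> carrier A; c \<in> carrier A\<rbrakk>
      \<Longrightarrow> \<phi> (a \<otimes> x) b c = \<phi> a (x \<otimes> b) c"
    and balanced_2: "\<And>a b x c. \<lbrakk>a \<in> carrier A; b \<in> carrier A; x \<in> B; c \<in> carrier A\<rbrakk>
      \<Longrightarrow> \<phi> a (b \<otimes> x) c = \<phi> a b (x \<otimes> c)"
  shows "\<exists>h \<in> hom (add_monoid (T 3)) (add_monoid M).
    \<forall>a \<in> carrier A. \<forall>b \<in> carrier A. \<forall>c \<in> carrier A. h (tens [a, b, c]) = \<phi> a b c"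
proof -
  have "\<exists>h \<in> hom (add_monoid (T 3)) (add_monoid M).
      \<forall>xs \<in> tensor_gens A 3. h (tens xs) = \<phi> (xs ! 0) (xs ! 1) (xs ! 2)"
    by (rule tensor_universal[OF M])
      (auto simp: tensor_gens_3 Cons_eq_append_conv append_eq_Cons_conv closed add_1 add_2 add_3 balanced_1 balanced_2)
  then show ?thesis by (elim bexE, intro bexI) (simp_all add: tensor_gens_3)
qed

lemma tens_closed2: "\<lbrakk>a \<in> carrier A; b \<in> carrier A\<rbrakk> \<Longrightarrow> tens [a, b] \<in> carrier (T 2)"
  by (rule tens_closed) (auto simp: tensor_gens_2)

lemma tens_closed3: "\<lbrakk>a \<in> carrier A; b \<in> carrier A; c \<in> carrier A\<rbrakk> \<Longrightarrow> tens [a, b, c] \<in> carrier (T 3)"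
  by (rule tens_closed) (auto simp: tensor_gens_3)

lemma tens_add_1: "\<lbrakk>a \<in> carrier A; a' \<in> carrier A\<rbrakk> \<Longrightarrow> tens [a \<oplus> a'] = tens [a] \<oplus>\<^bsub>T 1\<^esub> tens [a']"
  using tens_add[of "[]" a "[]" 1 a'] by (simp add: tensor_gens_def)

lemma tens_add_2:
  "\<lbrakk>a \<in> carrier A; a' \<in> carrier A; b \<in> carrier A\<rbrakk> \<Longrightarrow> tens [a \<oplus> a', b] = tens [a, b] \<oplus>\<^bsub>T 2\<^esub> tens [a', b]"
  "\<lbrakk>a \<in> carrier A; b \<in> carrier A; b' \<in> carrier A\<rbrakk> \<Longrightarrow> tens [a, b \<oplus> b'] = tens [a, b] \<oplus>\<^bsub>T 2\<^esub> tens [a, b']"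
  using tens_add[of "[]" a "[b]" 2 a'] tens_add[of "[a]" b "[]" 2 b'] by (simp_all add: tensor_gens_def)

lemma tens_balanced_2:
  "\<lbrakk>a \<in> carrier A; x \<in> B; b \<in> carrier A\<rbrakk> \<Longrightarrow> tens [a \<otimes> x, b] = tens [a, x \<otimes> b]"
  using tens_balanced[of "[]" a b "[]" 2 x] by (simp add: tensor_gens_def)

lemma tens_add_3:
  "\<lbrakk>a \<in> carrier A; a' \<in> carrier A; b \<in> carrier A; c \<in> carrier A\<rbrakk>
    \<Longrightarrow> tens [a \<oplus> a', b, c] = tens [a, b, c] \<oplus>\<^bsub>T 3\<^esub> tens [a', b, c]"
  "\<lbrakk>a \<in> carrier A; b \<in> carrier A; b' \<in> carrier A; c \<in> carrier A\<rbrakk>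
    \<Longrightarrow> tens [a, b \<oplus> b', c] = tens [a, b, c] \<oplus>\<^bsub>T 3\<^esub> tens [a, b', c]"
  "\<lbrakk>a \<in> carrier A; b \<in> carrier A; c \<in> carrier A; c' \<in> carrier A\<rbrakk>
    \<Longrightarrow> tens [a, b, c \<oplus> c'] = tens [a, b, c] \<oplus>\<^bsub>T 3\<^esub> tens [a, b, c']"
  using tens_add[of "[]" a "[b, c]" 3 a'] tens_add[of "[a]" b "[c]" 3 b'] tens_add[of "[a, b]" c "[]" 3 c']
  by (simp_all add: tensor_gens_def)

lemma tens_balanced_3:
  "\<lbrakk>a \<in> carrier A; x \<in> B; b \<in> carrier A; c \<in> carrier A\<rbrakk> \<Longrightarrow> tens [a \<otimes> x, b, c] = tens [a, x \<otimes> b, c]"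
  "\<lbrakk>a \<in> carrier A; b \<in> carrier A; x \<in> B; c \<in> carrier A\<rbrakk> \<Longrightarrow> tens [a, b \<otimes> x, c] = tens [a, b, x \<otimes> c]"
  using tens_balanced[of "[]" a b "[c]" 3 x] tens_balanced[of "[a]" b c "[]" 3 x]
  by (simp_all add: tensor_gens_def)

lemma lact_tens_2: "\<lbrakk>x \<in> carrier A; a \<in> carrier A; b \<in> carrier A\<rbrakk> \<Longrightarrow> lact (T 2) x (tens [a, b]) = tens [x \<otimes> a, b]"
  by (subst lact_tens) (auto simp: tensor_gens_2)

lemma ract_tens_2: "\<lbrakk>x \<in> carrier A; a \<in> carrier A; b \<in> carrier A\<rbrakk> \<Longrightarrow> ract (T 2) (tens [a, b]) x = tens [a, b \<otimes> x]"
  by (subst ract_tens) (auto simp: tensor_gens_2)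

lemma lact_tens_3:
  "\<lbrakk>x \<in> carrier A; a \<in> carrier A; b \<in> carrier A; c \<in> carrier A\<rbrakk> \<Longrightarrow> lact (T 3) x (tens [a, b, c]) = tens [x \<otimes> a, b, c]"
  by (subst lact_tens) (auto simp: tensor_gens_3)

lemma ract_tens_3:
  "\<lbrakk>x \<in> carrier A; a \<in> carrier A; b \<in> carrier A; c \<in> carrier A\<rbrakk> \<Longrightarrow> ract (T 3) (tens [a, b, c]) x = tens [a, b, c \<otimes> x]"
  by (subst ract_tens) (auto simp: tensor_gens_3)

lemma tens_1_hom: "(\<lambda>a. tens [a]) \<in> hom (add_monoid A) (add_monoid (T 1))"
proof (rule homI)
  fix a assume "a \<in> carrier (add_monoid A)"
  then show "tens [a] \<in> carrier (add_monoid (T 1))"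
    using tens_closed[of "[a]" 1] by (simp add: tensor_gens_def)
qed (simp add: tens_add_1 del: One_nat_def)

lemma tens_1_surj:
  assumes "X \<in> carrier (T 1)"
  shows "\<exists>a \<in> carrier A. X = tens [a]"
  using assms
proof (induction X rule: tensor_induct)
  case zero
  then show ?case
    using add_hom_zero[OF tens_1_hom abelian_group_axioms abelian_group_tensor_power] by (metis zero_closed)
next
  case (tens xs)
  then show ?case by (auto simp: tensor_gens_1 simp del: One_nat_def)
next
  case (diff X Y)
  then show ?case
    using add_hom_diff[OF tens_1_hom abelian_group_axioms abelian_group_tensor_power] by (metis minus_closed)
qed

text \<open>The universal property applied to the identity of \<open>A\<close> gives a left inverse
  of \<open>a \<mapsto> tens [a]\<close>. Together with \<open>tens_1_hom\<close> and
  \<open>tens_1_surj\<close> this identifies \<open>T 1\<close> with \<open>A\<close>.\<close>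

lemma tens_1_inj:
  assumes "a \<in> carrier A" "tens [a] = \<zero>\<^bsub>T 1\<^esub>"
  shows "a = \<zero>"
proof -
  have "(\<lambda>a. a) \<in> hom (add_monoid A) (add_monoid A)" by (auto simp: hom_def)
  from tensor_1_universal[OF abelian_group_axioms this]
  obtain h where h: "h \<in> hom (add_monoid (T 1)) (add_monoid A)" "\<forall>a \<in> carrier A. h (tens [a]) = a"
    by blast
  show ?thesis
    using add_hom_zero[OF h(1) abelian_group_tensor_power abelian_group_axioms] h(2) assms
    by metis
qed

lemma lact_tens_1: "\<lbrakk>x \<in> carrier A; a \<in> carrier A\<rbrakk> \<Longrightarrow> lact (T 1) x (tens [a]) = tens [x \<otimes> a]"
  by (subst lact_tens) (auto simp: tensor_gens_1 simp del: One_nat_def)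

lemma ract_tens_1: "\<lbrakk>x \<in> carrier A; a \<in> carrier A\<rbrakk> \<Longrightarrow> ract (T 1) (tens [a]) x = tens [a \<otimes> x]"
  by (subst ract_tens) (auto simp: tensor_gens_1 simp del: One_nat_def)

lemma tens_2_zero:
  assumes "a \<in> carrier A"
  shows "tens [\<zero>, a] = \<zero>\<^bsub>T 2\<^esub>" "tens [a, \<zero>] = \<zero>\<^bsub>T 2\<^esub>"
proof -
  have "(\<lambda>x. tens [x, a]) \<in> hom (add_monoid A) (add_monoid (T 2))"
    "(\<lambda>x. tens [a, x]) \<in> hom (add_monoid A) (add_monoid (T 2))"
    using assms by (auto intro!: homI simp: tens_closed2 tens_add_2)
  from this[THEN add_hom_zero, OF abelian_group_axioms abelian_group_tensor_power]
  show "tens [\<zero>, a] = \<zero>\<^bsub>T 2\<^esub>" "tens [a, \<zero>] = \<zero>\<^bsub>T 2\<^esub>" by auto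
qed

end

section \<open>Depth of a primary subring\<close>

text \<open>\<open>\<pi> i a\<close> is the coefficient of \<open>e i\<close> in \<open>a\<close>, as an element of the central subring \<open>K1\<close> of \<open>A\<close>.\<close>

locale primary_subring = subring_tensor A B for A :: "('a, 'z) ring_scheme" (structure) and B +
  fixes I :: "'i set" and e :: "'i \<Rightarrow> 'a" and \<pi> :: "'i \<Rightarrow> 'a \<Rightarrow> 'a" and J :: "'a set"
  assumes finite_I: "finite I"
    and two_points: "\<exists>i\<in>I. \<exists>j\<in>I. i \<noteq> j"
    and one_not_zero: "\<one> \<noteq> \<zero>"
    and e_closed: "i \<in> I \<Longrightarrow> e i \<in> carrier A"
    and e_orthogonal: "\<lbrakk>i \<in> I; j \<in> I; i \<noteq> j\<rbrakk> \<Longrightarrow> e i \<otimes> e j = \<zero>"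
    and ideal_J: "ideal J A"
    and J_sub: "J \<subseteq> B"
    and \<pi>_B: "\<lbrakk>i \<in> I; a \<in> carrier A\<rbrakk> \<Longrightarrow> \<pi> i a \<in> B"
    and \<pi>_central: "\<lbrakk>i \<in> I; a \<in> carrier A; c \<in> carrier A\<rbrakk> \<Longrightarrow> \<pi> i a \<otimes> c = c \<otimes> \<pi> i a"
    and \<pi>_add: "\<lbrakk>i \<in> I; a \<in> carrier A; c \<in> carrier A\<rbrakk> \<Longrightarrow> \<pi> i (a \<oplus> c) = \<pi> i a \<oplus> \<pi> i c"
    and \<pi>_mult: "\<lbrakk>i \<in> I; a \<in> carrier A; c \<in> carrier A\<rbrakk> \<Longrightarrow> \<pi> i (a \<otimes> c) = \<pi> i a \<otimes> \<pi> i c"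
    and \<pi>_J: "\<lbrakk>i \<in> I; x \<in> J\<rbrakk> \<Longrightarrow> \<pi> i x = \<zero>"
    and \<pi>_e: "i \<in> I \<Longrightarrow> \<pi> i (e i) = \<one>"
    and \<pi>_eq: "\<lbrakk>i \<in> I; j \<in> I; x \<in> B\<rbrakk> \<Longrightarrow> \<pi> i x = \<pi> j x"
    and B_diff: "\<lbrakk>i \<in> I; x \<in> B\<rbrakk> \<Longrightarrow> x \<ominus> \<pi> i x \<in> J"
    and expansion: "c \<in> carrier A \<Longrightarrow> c \<ominus> (\<Oplus>k\<in>I. \<pi> k c \<otimes> e k) \<in> J"
    and vertex_arrow: "i \<in> I \<Longrightarrow> \<exists>x\<in>J. \<forall>u\<in>carrier A. x \<otimes> u = \<zero> \<longrightarrow> u \<otimes> x = \<zero> \<longrightarrow> \<pi> i u = \<zero>"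
    and vertex_no_loop: "i \<in> I \<Longrightarrow> \<exists>x\<in>J. (x \<otimes> e i = \<zero> \<and> (\<forall>b\<in>B. x \<otimes> b = \<zero> \<longrightarrow> b \<in> J)) \<or>
      (e i \<otimes> x = \<zero> \<and> (\<forall>b\<in>B. b \<otimes> x = \<zero> \<longrightarrow> b \<in> J))"
begin

lemma \<pi>_closed: "\<lbrakk>i \<in> I; a \<in> carrier A\<rbrakk> \<Longrightarrow> \<pi> i a \<in> carrier A"
  using \<pi>_B B_closed by blast

lemma J_B: "x \<in> J \<Longrightarrow> x \<in> B"
  using J_sub by auto

lemma J_mult: "x \<in> J \<Longrightarrow> a \<in> carrier A \<Longrightarrow> a \<otimes> x \<in> J" "x \<in> J \<Longrightarrow> a \<in> carrier A \<Longrightarrow> x \<otimes> a \<in> J"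
  using ideal.I_l_closed[OF ideal_J] ideal.I_r_closed[OF ideal_J] by auto

lemma one_B: "\<one> \<in> B"
  using subringE(3)[OF subring_B] .

text \<open>Modulo \<open>J\<close>, the element \<open>u\<close> is the combination of the
  \<open>e k\<close> with coefficients \<open>\<pi> k u\<close>, by
  \<open>expansion\<close>.\<close>

lemma in_J_iff: "u \<in> carrier A \<Longrightarrow> (\<And>k. k \<in> I \<Longrightarrow> \<pi> k u = \<zero>) \<Longrightarrow> u \<in> J"
  using expansion[of u] e_closed
  by (simp add: minus_eq cong: finsum_cong)

section \<open>Generators of \<Omega>, the kernel of multiplication, and of its tensor product with
  \<open>A\<close>\<close>

definition D where "D a b = tens [a, b] \<ominus>\<^bsub>T 2\<^esub> tens [a \<otimes> b, \<one>]"

text \<open>This is \<open>D a b\<close> tensored with \<open>c\<close>, written inside the triple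
  tensor power; it stands for a generator of \<Omega> \<otimes> \<open>A\<close>.\<close>

definition E where "E a b c = tens [a, b, c] \<ominus>\<^bsub>T 3\<^esub> tens [a \<otimes> b, \<one>, c]"

lemma D_closed: "\<lbrakk>a \<in> carrier A; b \<in> carrier A\<rbrakk> \<Longrightarrow> D a b \<in> carrier (T 2)"
  by (simp add: D_def tens_closed2)

lemma E_closed: "\<lbrakk>a \<in> carrier A; b \<in> carrier A; c \<in> carrier A\<rbrakk> \<Longrightarrow> E a b c \<in> carrier (T 3)"
  by (simp add: E_def tens_closed3)

lemma D_add:
  "\<lbrakk>a \<in> carrier A; a' \<in> carrier A; b \<in> carrier A\<rbrakk> \<Longrightarrow> D (a \<oplus> a') b = D a b \<oplus>\<^bsub>T 2\<^esub> D a' b"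
  "\<lbrakk>a \<in> carrier A; b \<in> carrier A; b' \<in> carrier A\<rbrakk> \<Longrightarrow> D a (b \<oplus> b') = D a b \<oplus>\<^bsub>T 2\<^esub> D a b'"
  by (simp_all add: D_def tens_add_2 l_distr r_distr T.diff_add_diff tens_closed2)

lemma E_add:
  "\<lbrakk>a \<in> carrier A; a' \<in> carrier A; b \<in> carrier A; c \<in> carrier A\<rbrakk> \<Longrightarrow> E (a \<oplus> a') b c = E a b c \<oplus>\<^bsub>T 3\<^esub> E a' b c"
  "\<lbrakk>a \<in> carrier A; b \<in> carrier A; b' \<in> carrier A; c \<in> carrier A\<rbrakk> \<Longrightarrow> E a (b \<oplus> b') c = E a b c \<oplus>\<^bsub>T 3\<^esub> E a b' c"
  "\<lbrakk>a \<in> carrier A; b \<in> carrier A; c \<in> carrier A; c' \<in> carrier A\<rbrakk> \<Longrightarrow> E a b (c \<oplus> c') = E a b c \<oplus>\<^bsub>T 3\<^esub> E a b c'"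
  by (simp_all add: E_def tens_add_3 l_distr r_distr T.diff_add_diff tens_closed3)

text \<open>An element of \<open>B\<close> crosses the tensor sign, so \<open>D a\<close> depends on
  its second argument only modulo \<open>B\<close>.\<close>

lemma D_B: "\<lbrakk>a \<in> carrier A; x \<in> B\<rbrakk> \<Longrightarrow> D a x = \<zero>\<^bsub>T 2\<^esub>"
  using tens_balanced_2[of a x \<one>] by (simp add: D_def B_closed T.diff_self tens_closed2)

lemma E_B: "\<lbrakk>a \<in> carrier A; x \<in> B; c \<in> carrier A\<rbrakk> \<Longrightarrow> E a x c = \<zero>\<^bsub>T 3\<^esub>"
  using tens_balanced_3(1)[of a x \<one> c] by (simp add: E_def B_closed T.diff_self tens_closed3)

text \<open>As \<open>J\<close> is an ideal inside \<open>B\<close>, both \<open>y\<close> and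
  \<open>b \<otimes> y\<close> may cross a tensor sign. Therefore both terms of
  \<open>E a b y\<close> equal the tensor of \<open>a \<otimes> b \<otimes> y\<close> with two
  units.\<close>

lemma E_J:
  assumes "a \<in> carrier A" "b \<in> carrier A" "y \<in> J"
  shows "E a b y = \<zero>\<^bsub>T 3\<^esub>"
proof -
  have y: "y \<in> B" "y \<in> carrier A" "b \<otimes> y \<in> B" using assms J_B J_mult B_closed by auto
  have "tens [a, b, y] = tens [a, b \<otimes> y, \<one>]"
    using tens_balanced_3(2)[of a b y \<one>] assms y by simp
  also have "\<dots> = tens [a \<otimes> b \<otimes> y, \<one>, \<one>]"
    using tens_balanced_3(1)[of a "b \<otimes> y" \<one> \<one>] assms y by (simp add: m_assoc)
  also have "\<dots> = tens [a \<otimes> b, \<one>, y]"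
    using tens_balanced_3(1)[of "a \<otimes> b" y \<one> \<one>] tens_balanced_3(2)[of "a \<otimes> b" \<one> y \<one>] assms y by simp
  finally show ?thesis using assms y by (simp add: E_def T.diff_self tens_closed3)
qed

text \<open>The decomposition of \<open>B\<close> into scalars and \<open>J\<close>, multiplied by
  \<open>z\<close> from the left.\<close>

lemma B_split:
  assumes "k \<in> I" "x \<in> B" "z \<in> carrier A"
  shows "z \<otimes> x = z \<otimes> (x \<ominus> \<pi> k x) \<oplus> z \<otimes> \<pi> k x"
    and "z \<otimes> (x \<ominus> \<pi> k x) \<in> J"
proof -
  have "x \<in> carrier A" "\<pi> k x \<in> carrier A" using assms B_closed \<pi>_closed by auto
  then have "x = (x \<ominus> \<pi> k x) \<oplus> \<pi> k x" by (simp add: minus_eq a_assoc l_neg)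
  then show "z \<otimes> x = z \<otimes> (x \<ominus> \<pi> k x) \<oplus> z \<otimes> \<pi> k x"
    using assms \<open>x \<in> carrier A\<close> \<open>\<pi> k x \<in> carrier A\<close> by (metis minus_closed r_distr)
  show "z \<otimes> (x \<ominus> \<pi> k x) \<in> J" using assms B_diff J_mult by auto
qed

text \<open>The part of \<open>z \<otimes> x\<close> in \<open>J\<close>, and hence in
  \<open>B\<close>, is killed by \<open>D a\<close>. So \<open>B\<close> acts on \<Omega> from the
  right through the scalars \<open>\<pi> k x\<close>.\<close>

lemma D_mult_B:
  assumes "k \<in> I" "x \<in> B" "z \<in> carrier A" "a \<in> carrier A"
  shows "D a (z \<otimes> x) = D a (z \<otimes> \<pi> k x)"
proof -
  note s = B_split[OF assms(1-3)]
  have "D a (z \<otimes> x) = D a (z \<otimes> (x \<ominus> \<pi> k x)) \<oplus>\<^bsub>T 2\<^esub> D a (z \<otimes> \<pi> k x)"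
    using s assms D_add(2) J_B B_closed \<pi>_closed by simp
  then show ?thesis using s assms J_B B_closed \<pi>_closed by (simp add: D_B D_closed)
qed

lemma E_mult_B_2:
  assumes "k \<in> I" "x \<in> B" "z \<in> carrier A" "a \<in> carrier A" "c \<in> carrier A"
  shows "E a (z \<otimes> x) c = E a (z \<otimes> \<pi> k x) c"
proof -
  note s = B_split[OF assms(1-3)]
  have "E a (z \<otimes> x) c = E a (z \<otimes> (x \<ominus> \<pi> k x)) c \<oplus>\<^bsub>T 3\<^esub> E a (z \<otimes> \<pi> k x) c"
    using s assms E_add(2) J_B B_closed \<pi>_closed by simp
  then show ?thesis using s assms J_B B_closed \<pi>_closed by (simp add: E_B E_closed)
qed

text \<open>The same argument in the last factor, where the part in \<open>J\<close> dies by
  \<open>E_J\<close>.\<close>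

lemma E_mult_B_3:
  assumes "k \<in> I" "x \<in> B" "z \<in> carrier A" "a \<in> carrier A" "b \<in> carrier A"
  shows "E a b (z \<otimes> x) = E a b (z \<otimes> \<pi> k x)"
proof -
  note s = B_split[OF assms(1-3)]
  have "E a b (z \<otimes> x) = E a b (z \<otimes> (x \<ominus> \<pi> k x)) \<oplus>\<^bsub>T 3\<^esub> E a b (z \<otimes> \<pi> k x)"
    using s assms E_add(3) J_B B_closed \<pi>_closed by simp
  then show ?thesis using s assms J_B B_closed \<pi>_closed by (simp add: E_J E_closed)
qed

text \<open>Both terms of \<open>E\<close> are balanced separately: the scalar lies in
  \<open>B\<close>, and in the second term it passes through the unit in the middle.\<close>

lemma E_balanced:
  assumes "k \<in> I" "x \<in> carrier A" "a \<in> carrier A" "b \<in> carrier A" "c \<in> carrier A"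
  shows "E a (b \<otimes> \<pi> k x) c = E a b (\<pi> k x \<otimes> c)"
proof -
  have p: "\<pi> k x \<in> B" "\<pi> k x \<in> carrier A" using assms \<pi>_B \<pi>_closed by auto
  have "tens [a \<otimes> b \<otimes> \<pi> k x, \<one>, c] = tens [a \<otimes> b, \<one>, \<pi> k x \<otimes> c]"
    using tens_balanced_3(1)[of "a \<otimes> b" "\<pi> k x" \<one> c] tens_balanced_3(2)[of "a \<otimes> b" \<one> "\<pi> k x" c] assms p by simp
  then show ?thesis
    using tens_balanced_3(2)[of a b "\<pi> k x" c] assms p by (simp add: E_def m_assoc)
qed

lemma lact_D: "\<lbrakk>x \<in> carrier A; a \<in> carrier A; b \<in> carrier A\<rbrakk> \<Longrightarrow> lact (T 2) x (D a b) = D (x \<otimes> a) b"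
  using add_hom_diff[OF lact_tensor_hom[of x 2] abelian_group_tensor_power abelian_group_tensor_power]
  by (simp add: D_def tens_closed2 lact_tens_2 m_assoc)

text \<open>The second term becomes \<open>tens [a \<otimes> b, x]\<close>, and only for
  \<open>x\<close> in \<open>B\<close> can \<open>x\<close> be moved to the left to recover the
  shape of \<open>D\<close>. This is why right depth is computed with \<open>A\<close> on the left
  and \<open>B\<close> on the right.\<close>

lemma ract_D: "\<lbrakk>x \<in> B; a \<in> carrier A; b \<in> carrier A\<rbrakk> \<Longrightarrow> ract (T 2) (D a b) x = D a (b \<otimes> x)"
  using add_hom_diff[OF ract_tensor_hom[of x 2] abelian_group_tensor_power abelian_group_tensor_power]
    tens_balanced_2[of "a \<otimes> b" x \<one>]
  by (simp add: D_def B_closed tens_closed2 ract_tens_2 m_assoc)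

lemma lact_E:
  "\<lbrakk>x \<in> carrier A; a \<in> carrier A; b \<in> carrier A; c \<in> carrier A\<rbrakk> \<Longrightarrow> lact (T 3) x (E a b c) = E (x \<otimes> a) b c"
  using add_hom_diff[OF lact_tensor_hom[of x 3] abelian_group_tensor_power abelian_group_tensor_power]
  by (simp add: E_def tens_closed3 lact_tens_3 m_assoc)

lemma ract_E:
  "\<lbrakk>x \<in> carrier A; a \<in> carrier A; b \<in> carrier A; c \<in> carrier A\<rbrakk> \<Longrightarrow> ract (T 3) (E a b c) x = E a b (c \<otimes> x)"
  using add_hom_diff[OF ract_tensor_hom[of x 3] abelian_group_tensor_power abelian_group_tensor_power]
  by (simp add: E_def tens_closed3 ract_tens_3 m_assoc)

section \<open>Right depth 4\<close>

abbreviation AB where "AB \<equiv> A\<lparr>carrier := B\<rparr>"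

lemma bimodule_T:
  assumes "m \<ge> 1"
  shows "bimodule A A (T m)" "bimodule A AB (T m)" "bimodule AB AB (T m)"
  using bimodule_subring[OF bimodule_tensor_power[OF assms]] carrier_is_subring subring_B
  by (force simp: bimodule_tensor_power[OF assms])+

text \<open>Together with \<open>ex_unit_map\<close>, this splits \<open>T 2\<close> off
  \<open>T 3\<close>. Multiplying the first two factors is the choice that kills every
  \<open>E a b c\<close>.\<close>

lemma ex_mult_map:
  "\<exists>h \<in> bimod_hom A AB (T 3) (T 2). \<forall>a \<in> carrier A. \<forall>b \<in> carrier A. \<forall>c \<in> carrier A.
    h (tens [a, b, c]) = tens [a \<otimes> b, c]"
proof -
  obtain h where h: "h \<in> hom (add_monoid (T 3)) (add_monoid (T 2))"
    and ht: "\<forall>a \<in> carrier A. \<forall>b \<in> carrier A. \<forall>c \<in> carrier A. h (tens [a, b, c]) = tens [a \<otimes> b, c]"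
    using tensor_3_universal[OF abelian_group_tensor_power, of "\<lambda>a b c. tens [a \<otimes> b, c]" 2]
    by (auto simp: tens_closed2 l_distr r_distr tens_add_2 m_assoc B_closed tens_balanced_2[symmetric])
  have "h \<in> bimod_hom A AB (T 3) (T 2)"
    by (rule tensor_bimod_homI[OF h bimodule_T(2)])
      (auto simp: B_closed tensor_gens_3 ht lact_tens_2 ract_tens_2 m_assoc)
  with ht show ?thesis by blast
qed

lemma ex_unit_map:
  "\<exists>h \<in> bimod_hom A AB (T 2) (T 3). \<forall>a \<in> carrier A. \<forall>b \<in> carrier A. h (tens [a, b]) = tens [a, \<one>, b]"
proof -
  have bal: "tens [a \<otimes> x, \<one>, b] = tens [a, \<one>, x \<otimes> b]" if "a \<in> carrier A" "x \<in> B" "b \<in> carrier A" for a x b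
    using tens_balanced_3(1)[of a x \<one> b] tens_balanced_3(2)[of a \<one> x b] that B_closed by simp
  obtain h where h: "h \<in> hom (add_monoid (T 2)) (add_monoid (T 3))"
    and ht: "\<forall>a \<in> carrier A. \<forall>b \<in> carrier A. h (tens [a, b]) = tens [a, \<one>, b]"
    using tensor_2_universal[OF abelian_group_tensor_power, of "\<lambda>a b. tens [a, \<one>, b]" 3]
    by (auto simp: tens_closed3 tens_add_3 bal)
  have "h \<in> bimod_hom A AB (T 2) (T 3)"
    by (rule tensor_bimod_homI[OF h bimodule_T(2)])
      (auto simp: B_closed tensor_gens_2 ht lact_tens_3 ract_tens_3)
  with ht show ?thesis by blast
qed

text \<open>The coordinate at \<open>k\<close> of \<Omega> \<otimes> \<open>A\<close>: it sends
  \<open>E a b c\<close> to \<open>D a b\<close> times the scalar \<open>\<pi> k c\<close>, and it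
  kills tensors with middle factor \<one>, because \<open>D a\<close> vanishes on
  \<open>B\<close>.\<close>

lemma ex_D_map:
  assumes k: "k \<in> I"
  shows "\<exists>h \<in> bimod_hom A AB (T 3) (T 2). \<forall>a \<in> carrier A. \<forall>b \<in> carrier A. \<forall>c \<in> carrier A.
    h (tens [a, b, c]) = D a (b \<otimes> \<pi> k c)"
proof -
  note p = \<pi>_closed[OF k]
  have bal1: "D (a \<otimes> x) (b \<otimes> \<pi> k c) = D a (x \<otimes> b \<otimes> \<pi> k c)"
    if "a \<in> carrier A" "x \<in> B" "b \<in> carrier A" "c \<in> carrier A" for a x b c
    using that tens_balanced_2[of a x "b \<otimes> \<pi> k c"] by (simp add: D_def m_assoc B_closed p)
  have scal: "D a (b \<otimes> \<pi> k c \<otimes> x) = D a (b \<otimes> (\<pi> k c \<otimes> \<pi> k x))"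
    if "a \<in> carrier A" "x \<in> B" "b \<in> carrier A" "c \<in> carrier A" for a x b c
    using D_mult_B[OF k that(2), of "b \<otimes> \<pi> k c" a] that by (simp add: m_assoc p B_closed)
  \<comment> \<open>Here \<open>x\<close> has to pass from the middle factor into
    \<open>\<pi> k\<close>. It acts on \<open>D a\<close> as the scalar \<open>\<pi> k x\<close>,
    and scalars are central.\<close>
  have bal2: "D a (b \<otimes> x \<otimes> \<pi> k c) = D a (b \<otimes> \<pi> k (x \<otimes> c))"
    if "a \<in> carrier A" "x \<in> B" "b \<in> carrier A" "c \<in> carrier A" for a x b c
  proof -
    have "b \<otimes> x \<otimes> \<pi> k c = b \<otimes> \<pi> k c \<otimes> x"
      using that \<pi>_central[OF k that(4) B_closed[OF that(2)]] by (simp add: m_assoc p B_closed)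
    moreover have "\<pi> k (x \<otimes> c) = \<pi> k c \<otimes> \<pi> k x"
      using that \<pi>_central[OF k that(4), of "\<pi> k x"] by (simp add: \<pi>_mult[OF k] B_closed p)
    ultimately show ?thesis using scal[OF that] by simp
  qed
  obtain h where h: "h \<in> hom (add_monoid (T 3)) (add_monoid (T 2))"
    and ht: "\<forall>a \<in> carrier A. \<forall>b \<in> carrier A. \<forall>c \<in> carrier A. h (tens [a, b, c]) = D a (b \<otimes> \<pi> k c)"
    using tensor_3_universal[OF abelian_group_tensor_power, of "\<lambda>a b c. D a (b \<otimes> \<pi> k c)" 2]
    by (auto simp: D_closed p D_add l_distr r_distr \<pi>_add[OF k] bal1 bal2)
  have "h \<in> bimod_hom A AB (T 3) (T 2)"
    by (rule tensor_bimod_homI[OF h bimodule_T(2)])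
      (auto simp: B_closed tensor_gens_3 ht lact_D ract_D p \<pi>_mult[OF k] scal)
  with ht show ?thesis by blast
qed

text \<open>The projection of \<open>T 2\<close> onto \<Omega>, taking \<open>tens [a, b]\<close> to
  \<open>D a b\<close>, followed by the insertion of \<open>e k\<close> as last factor.\<close>

lemma ex_E_map:
  assumes k: "k \<in> I"
  shows "\<exists>h \<in> bimod_hom A AB (T 2) (T 3). \<forall>a \<in> carrier A. \<forall>b \<in> carrier A. h (tens [a, b]) = E a b (e k)"
proof -
  note ek = e_closed[OF k] and p = \<pi>_closed[OF k]
  have bal: "E (a \<otimes> x) b (e k) = E a (x \<otimes> b) (e k)"
    if "a \<in> carrier A" "x \<in> B" "b \<in> carrier A" for a x b
    using that ek tens_balanced_3(1)[of a x b "e k"] by (simp add: E_def m_assoc B_closed)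
  \<comment> \<open>On either side \<open>x\<close> may be replaced by the scalar
    \<open>\<pi> k x\<close>, which commutes with \<open>e k\<close> and crosses the last tensor
    sign.\<close>
  have r: "E a (b \<otimes> x) (e k) = E a b (e k \<otimes> x)"
    if "a \<in> carrier A" "x \<in> B" "b \<in> carrier A" for a x b
    using that ek E_mult_B_2[OF k, of x b a "e k"] E_mult_B_3[OF k, of x "e k" a b] E_balanced[OF k, of x a b "e k"]
      \<pi>_central[OF k, of x "e k"]
    by (simp add: B_closed)
  obtain h where h: "h \<in> hom (add_monoid (T 2)) (add_monoid (T 3))"
    and ht: "\<forall>a \<in> carrier A. \<forall>b \<in> carrier A. h (tens [a, b]) = E a b (e k)"
    using tensor_2_universal[OF abelian_group_tensor_power, of "\<lambda>a b. E a b (e k)" 3]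
    by (auto simp: E_closed E_add bal ek)
  have "h \<in> bimod_hom A AB (T 2) (T 3)"
    by (rule tensor_bimod_homI[OF h bimodule_T(2)])
      (auto simp: B_closed tensor_gens_2 ht lact_E ract_E ek r)
  with ht show ?thesis by blast
qed

text \<open>By \<open>E_J\<close> the last argument matters only modulo \<open>J\<close>, where
  \<open>expansion\<close> writes \<open>c\<close> in terms of the \<open>e k\<close>. This makes
  the composites of the maps from \<open>ex_D_map\<close> and \<open>ex_E_map\<close> add up to the
  projection of \<open>T 3\<close> onto \<Omega> \<otimes> \<open>A\<close>.\<close>

lemma E_expansion:
  assumes "a \<in> carrier A" "b \<in> carrier A" "c \<in> carrier A"
  shows "(\<Oplus>\<^bsub>T 3\<^esub>k\<in>I. E a b (\<pi> k c \<otimes> e k)) = E a b c"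
proof -
  have h: "E a b \<in> hom (add_monoid A) (add_monoid (T 3))"
    using assms by (intro homI) (simp_all add: E_closed E_add)
  let ?s = "\<Oplus>k\<in>I. \<pi> k c \<otimes> e k"
  have s: "?s \<in> carrier A" using assms \<pi>_closed e_closed by (intro finsum_closed) auto
  have "(\<Oplus>\<^bsub>T 3\<^esub>k\<in>I. E a b (\<pi> k c \<otimes> e k)) = E a b ?s"
    using assms \<pi>_closed e_closed
    by (intro add_hom_finsum[OF h abelian_group_axioms abelian_group_tensor_power, symmetric]) auto
  also have "\<dots> = E a b (c \<ominus> ?s) \<oplus>\<^bsub>T 3\<^esub> E a b ?s"
    using E_J[OF assms(1,2) expansion[OF assms(3)]] assms s by (simp add: E_closed)
  also have "\<dots> = E a b ((c \<ominus> ?s) \<oplus> ?s)"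
    using assms s by (simp add: E_add)
  also have "(c \<ominus> ?s) \<oplus> ?s = c" using assms s by (simp add: minus_eq a_assoc l_neg)
  finally show ?thesis .
qed

text \<open>The decomposition of \<open>T 3\<close> into \<open>T 2\<close> and \<Omega> \<otimes>
  \<open>A\<close> enters through maps only: \<open>f0\<close> and \<open>g0\<close> belong to the
  first summand, \<open>f k\<close> and \<open>g k\<close> to the copies of \<Omega> indexed by
  \<open>I\<close>.\<close>

lemma right_depth_4: "right_even_depth B A 2"
proof -
  obtain f0 where f0: "f0 \<in> bimod_hom A AB (T 3) (T 2)"
    and f0t: "\<And>a b c. \<lbrakk>a \<in> carrier A; b \<in> carrier A; c \<in> carrier A\<rbrakk> \<Longrightarrow> f0 (tens [a, b, c]) = tens [a \<otimes> b, c]"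
    using ex_mult_map by blast
  obtain g0 where g0: "g0 \<in> bimod_hom A AB (T 2) (T 3)"
    and g0t: "\<And>a b. \<lbrakk>a \<in> carrier A; b \<in> carrier A\<rbrakk> \<Longrightarrow> g0 (tens [a, b]) = tens [a, \<one>, b]"
    using ex_unit_map by blast
  obtain f where f: "\<And>k. k \<in> I \<Longrightarrow> f k \<in> bimod_hom A AB (T 3) (T 2)"
    and ft: "\<And>k a b c. \<lbrakk>k \<in> I; a \<in> carrier A; b \<in> carrier A; c \<in> carrier A\<rbrakk> \<Longrightarrow> f k (tens [a, b, c]) = D a (b \<otimes> \<pi> k c)"
    using ex_D_map by metis
  obtain g where g: "\<And>k. k \<in> I \<Longrightarrow> g k \<in> bimod_hom A AB (T 2) (T 3)"
    and gt: "\<And>k a b. \<lbrakk>k \<in> I; a \<in> carrier A; b \<in> carrier A\<rbrakk> \<Longrightarrow> g k (tens [a, b]) = E a b (e k)"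
    using ex_E_map by metis
  have hom: "h \<in> hom (add_monoid (T m)) (add_monoid (T n))" if "h \<in> bimod_hom A AB (T m) (T n)" for h m n
    using that by (simp add: bimod_hom_def)
  have comp: "(\<lambda>X. p (q X)) \<in> hom (add_monoid (T m)) (add_monoid (T m))"
    if "p \<in> hom (add_monoid (T n)) (add_monoid (T m))" "q \<in> hom (add_monoid (T m)) (add_monoid (T n))" for p q m n
    using that by (auto simp: hom_def Pi_def)
  have id: "(\<lambda>X. X) \<in> hom (add_monoid (T m)) (add_monoid (T m))" for m by (auto simp: hom_def)
  have "bimod_divides A AB (T 2) (bimod_power (card {()}) (T 3))"
  proof (rule bimod_divides_powerI[where f = "\<lambda>_. g0" and g = "\<lambda>_. f0"])
    fix X assume X: "X \<in> carrier (T 2)"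
    have "f0 (g0 X) = X"
      by (rule tensor_hom_eqI[OF comp[OF hom[OF f0] hom[OF g0]] id abelian_group_tensor_power X])
        (auto simp: tensor_gens_2 f0t g0t)
    then show "finsum (T 2) (\<lambda>_. f0 (g0 X)) {()} = X" using X by simp
  qed (use f0 g0 in \<open>auto simp: bimodule_T\<close>)
  \<comment> \<open>The index \<open>None\<close> stands for the summand \<open>T 2\<close>, and
    \<open>Some k\<close> for the copy of \<Omega> at \<open>k\<close>. On pure tensors the two
    contributions are \<open>tens [a \<otimes> b, \<one>, c]\<close> and \<open>E a b c\<close>,
    which add up to \<open>tens [a, b, c]\<close>.\<close>
  moreover have "bimod_divides A AB (T 3) (bimod_power (card (insert None (Some ` I))) (T 2))"
  proof (rule bimod_divides_powerI[where f = "case_option f0 f" and g = "case_option g0 g"])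
    fix X assume X: "X \<in> carrier (T 3)"
    have gfc: "(\<lambda>X. g k (f k X)) \<in> hom (add_monoid (T 3)) (add_monoid (T 3))" if "k \<in> I" for k
      using comp[OF hom[OF g[OF that]] hom[OF f[OF that]]] .
    have gf0c: "(\<lambda>X. g0 (f0 X)) \<in> hom (add_monoid (T 3)) (add_monoid (T 3))"
      using comp[OF hom[OF g0] hom[OF f0]] .
    have "finsum (T 3) (\<lambda>i. case_option g0 g i (case_option f0 f i X)) (insert None (Some ` I)) =
        g0 (f0 X) \<oplus>\<^bsub>T 3\<^esub> (\<Oplus>\<^bsub>T 3\<^esub>k\<in>I. g k (f k X))"
    proof -
      let ?G = "\<lambda>i. case_option g0 g i (case_option f0 f i X)"
      have G: "?G \<in> Some ` I \<rightarrow> carrier (T 3)" "?G None \<in> carrier (T 3)"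
        using X add_hom_closed[OF gfc] add_hom_closed[OF gf0c] by auto
      have "finsum (T 3) ?G (Some ` I) = (\<Oplus>\<^bsub>T 3\<^esub>k\<in>I. ?G (Some k))"
        by (rule T.finsum_reindex[OF G(1)]) simp
      then show ?thesis using finite_I T.finsum_insert[OF _ _ G] by simp
    qed
    also have "\<dots> = X"
    proof (rule tensor_hom_eqI[OF T.add_hom_sum[OF gf0c T.add_hom_finsum_pointwise[OF gfc]] id abelian_group_tensor_power X])
      fix xs assume "xs \<in> tensor_gens A 3"
      then obtain a b c where abc: "a \<in> carrier A" "b \<in> carrier A" "c \<in> carrier A" "xs = [a, b, c]"
        by (auto simp: tensor_gens_3)
      \<comment> \<open>Applying \<open>g k\<close> to \<open>D a ?z\<close> produces a second term
        \<open>E (a \<otimes> ?z) \<one> (e k)\<close>, which is zero since \<one> lies in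
        \<open>B\<close>. The scalar is then moved to the last factor by
        \<open>E_balanced\<close>.\<close>
      have gf: "g k (f k (tens xs)) = E a b (\<pi> k c \<otimes> e k)" if k: "k \<in> I" for k
      proof -
        let ?z = "b \<otimes> \<pi> k c"
        have z: "?z \<in> carrier A" using abc \<pi>_closed[OF k] by simp
        have "g k (D a ?z) = E a ?z (e k) \<ominus>\<^bsub>T 3\<^esub> E (a \<otimes> ?z) \<one> (e k)"
          unfolding D_def using abc z k
          by (simp add: add_hom_diff[OF hom[OF g[OF k]] abelian_group_tensor_power abelian_group_tensor_power]
              tens_closed2 gt)
        then show ?thesis
          using abc z k e_closed[OF k] \<pi>_closed[OF k]
          by (simp add: ft E_B[OF _ one_B] E_closed T.minus_eq E_balanced)
      qed
      have "(\<Oplus>\<^bsub>T 3\<^esub>k\<in>I. g k (f k (tens xs))) = E a b c"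
        unfolding E_expansion[OF abc(1-3), symmetric]
        by (rule T.finsum_cong') (use abc \<pi>_closed e_closed gf in \<open>simp_all add: E_closed Pi_def\<close>)
      moreover have "g0 (f0 (tens xs)) = tens [a \<otimes> b, \<one>, c]"
        using abc by (simp add: f0t g0t)
      moreover have "tens [a \<otimes> b, \<one>, c] \<oplus>\<^bsub>T 3\<^esub> E a b c = tens xs"
        using abc T.diff_eq_iff[of "tens [a, b, c]" 3 "tens [a \<otimes> b, \<one>, c]" "E a b c"]
        by (simp add: E_def[symmetric] tens_closed3 E_closed T.a_comm[of "tens [a \<otimes> b, \<one>, c]"])
      ultimately show "g0 (f0 (tens xs)) \<oplus>\<^bsub>T 3\<^esub> (\<Oplus>\<^bsub>T 3\<^esub>k\<in>I. g k (f k (tens xs))) = tens xs"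
        by simp
    qed auto
    finally show "finsum (T 3) (\<lambda>i. case_option g0 g i (case_option f0 f i X)) (insert None (Some ` I)) = X" .
  qed (use f0 g0 f g finite_I in \<open>auto simp: bimodule_T\<close>)
  moreover have "card (insert None (Some ` I)) \<ge> 1"
    using finite_I by (simp add: card_gt_0_iff Suc_le_eq)
  ultimately show ?thesis
    unfolding right_even_depth_def H_equivalent_def
    by (intro exI[of _ "card {()}"] exI[of _ "card (insert None (Some ` I))"]) simp
qed

section \<open>Failure of depths 1, 2 and 3\<close>

lemma vanishing_on_JT:
  assumes \<beta>: "\<beta> \<in> hom (add_monoid (T m)) (add_monoid A)" and m: "m \<ge> 1" and x: "x \<in> J"
    and X: "X \<in> carrier (T m)"
    and eq: "\<And>xs. xs \<in> tensor_gens A m \<Longrightarrow> \<beta> (tens ((x \<otimes> hd xs) # tl xs)) = \<zero>"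
  shows "\<beta> (lact (T m) x X) = \<zero>"
proof -
  have xA: "x \<in> carrier A" using x J_B B_closed by auto
  show ?thesis
    using tensor_hom_eqI[OF hom_compose[OF lact_tensor_hom[OF xA m] \<beta>, unfolded comp_def] _ abelian_group_axioms X,
        of "\<lambda>_. \<zero>"] eq lact_tens[OF xA m]
    by (auto simp: hom_def)
qed

text \<open>
  \<open>e i \<otimes> e j\<close> spans a copy of the trivial \<open>B\<close>-\<open>B\<close>-bimodule, whereas the elements of \<open>A\<close> annihilated by
  \<open>J\<close> on both sides lie in \<open>J\<close>.
\<close>

lemma tensor_square_not_divides: "\<not> bimod_divides AB AB (T 2) (bimod_power s (T 1))"
proof -
  obtain i j where ij: "i \<in> I" "j \<in> I" "i \<noteq> j" using two_points by blast
  note ei = e_closed[OF ij(1)] and ej = e_closed[OF ij(2)]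
  note pi = \<pi>_closed[OF ij(1)] and pj = \<pi>_closed[OF ij(2)]
  let ?u = "tens [e i, e j]"
  \<comment> \<open>This functional is balanced because \<open>\<pi> i\<close> and
    \<open>\<pi> j\<close> agree on \<open>B\<close>.\<close>
  obtain \<beta> where \<beta>: "\<beta> \<in> hom (add_monoid (T 2)) (add_monoid A)"
    and \<beta>t: "\<forall>a \<in> carrier A. \<forall>b \<in> carrier A. \<beta> (tens [a, b]) = \<pi> i a \<otimes> \<pi> j b"
    using tensor_2_universal[OF abelian_group_axioms, of "\<lambda>a b. \<pi> i a \<otimes> \<pi> j b"] ij
    by (auto simp: pi pj \<pi>_add l_distr r_distr \<pi>_mult B_closed m_assoc \<pi>_eq[of i j])
  have f: "\<exists>b\<in>J. f ?u = lact (T 1) b (tens [\<one>])" if f: "f \<in> bimod_hom AB AB (T 2) (T 1)" for f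
  proof -
    have fl: "f (lact (T 2) x X) = lact (T 1) x (f X)" and fr: "f (ract (T 2) X x) = ract (T 1) (f X) x"
      if "x \<in> B" "X \<in> carrier (T 2)" for x X
      using f that by (auto simp: bimod_hom_def)
    have u: "?u \<in> carrier (T 2)" using ei ej by (rule tens_closed2)
    then have "f ?u \<in> carrier (T 1)" using f add_hom_closed by (auto simp: bimod_hom_def)
    then obtain a where a: "a \<in> carrier A" "f ?u = tens [a]" using tens_1_surj by blast
    have f0: "f \<zero>\<^bsub>T 2\<^esub> = \<zero>\<^bsub>T 1\<^esub>"
      by (rule bimod_hom_zero[OF f]) (simp_all add: bimodule_T)
    have "x \<otimes> a = \<zero> \<and> a \<otimes> x = \<zero>" if x: "x \<in> J" for x
    proof -
      have xB: "x \<in> B" and xA: "x \<in> carrier A" using x J_B B_closed by auto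
      have "x \<otimes> e i \<in> B" "e j \<otimes> x \<in> B" using x J_mult J_B ei ej by auto
      \<comment> \<open>\<open>x \<otimes> e i\<close> lies in \<open>J\<close>, so it may cross the
        tensor sign, where \<open>e i\<close> meets \<open>e j\<close> and the product vanishes. The
        right action is symmetric.\<close>
      have "lact (T 2) x ?u = tens [\<one>, x \<otimes> e i \<otimes> e j]"
        using tens_balanced_2[OF one_closed \<open>x \<otimes> e i \<in> B\<close> ej] ei ej xA by (simp add: lact_tens_2)
      also have "\<dots> = \<zero>\<^bsub>T 2\<^esub>"
        using e_orthogonal[OF ij] ei ej xA by (simp add: m_assoc tens_2_zero)
      finally have "tens [x \<otimes> a] = \<zero>\<^bsub>T 1\<^esub>"
        using fl[OF xB u] f0 a xA by (simp add: lact_tens_1[symmetric] del: One_nat_def)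
      moreover have "ract (T 2) ?u x = tens [e i \<otimes> (e j \<otimes> x), \<one>]"
        using tens_balanced_2[OF ei \<open>e j \<otimes> x \<in> B\<close> one_closed] ei ej xA by (simp add: ract_tens_2)
      then have "ract (T 2) ?u x = \<zero>\<^bsub>T 2\<^esub>"
        using e_orthogonal[OF ij] ei ej xA by (simp add: m_assoc[symmetric] tens_2_zero)
      then have "tens [a \<otimes> x] = \<zero>\<^bsub>T 1\<^esub>"
        using fr[OF xB u] f0 a xA by (simp add: ract_tens_1[symmetric] del: One_nat_def)
      ultimately show ?thesis using tens_1_inj a xA by simp
    qed
    \<comment> \<open>By \<open>vertex_arrow\<close> some element of \<open>J\<close> detects the
      coefficient at \<open>k\<close>; in the path algebra it is an arrow incident to the
      vertex.\<close>
    then have "\<pi> k a = \<zero>" if "k \<in> I" for k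
      using vertex_arrow[OF that] a by blast
    then have "a \<in> J" using in_J_iff a by blast
    moreover have "f ?u = lact (T 1) a (tens [\<one>])" using a by (simp add: lact_tens_1 del: One_nat_def)
    ultimately show ?thesis by blast
  qed
  show ?thesis
  proof (rule not_bimod_divides_power[where u = "?u" and n = "tens [\<one>]" and J = J and \<beta> = \<beta> and C = A])
    show "tens [\<one>] \<in> carrier (T 1)" by (rule add_hom_closed[OF tens_1_hom one_closed])
    show "\<beta> (lact (T 2) b y) = \<zero>" if "b \<in> J" "y \<in> carrier (T 2)" for b y
    proof (rule vanishing_on_JT[OF \<beta> _ that])
      fix xs assume "xs \<in> tensor_gens A 2"
      then show "\<beta> (tens ((b \<otimes> hd xs) # tl xs)) = \<zero>"
        using \<beta>t ij \<pi>_J J_mult(2)[OF that(1)] J_B B_closed by (auto simp: tensor_gens_2 pj)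
    qed simp
    show "\<beta> ?u \<noteq> \<zero>" using \<beta>t ei ej \<pi>_e ij one_not_zero by simp
  qed (use f ei ej \<beta> J_sub in \<open>auto simp: bimodule_T tens_closed2 abelian_group_axioms simp del: One_nat_def\<close>)
qed

lemma bimodule_subring_bimod: "bimodule AB AB (subring_bimod B A)"
proof -
  interpret AB: ring AB by (rule subring_is_ring[OF subring_B])
  have "abelian_group (subring_bimod B A)"
    by (rule abelian_groupI) (use AB.add.m_closed AB.add.l_inv_ex in \<open>auto simp: subring_bimod_def B_closed a_ac subringE[OF subring_B]\<close>)
  then interpret S: abelian_group "subring_bimod B A" .
  show ?thesis
    by unfold_locales (auto simp: subring_bimod_def B_closed l_distr r_distr m_assoc subringE[OF subring_B])
qed

text \<open>By \<open>vertex_no_loop\<close> some \<open>x\<close> in \<open>J\<close> annihilates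
  \<open>e i\<close> on one side. A homomorphism into \<open>B\<close> sends \<open>e i\<close> to
  an element of \<open>B\<close> annihilated by \<open>x\<close> on that side, which forces it into
  \<open>J\<close>. The functional \<open>\<pi> i\<close> vanishes on \<open>J T 1\<close> but not
  at \<open>e i\<close>.\<close>

lemma algebra_not_divides: "\<not> bimod_divides AB AB (T 1) (bimod_power s (subring_bimod B A))"
proof -
  obtain i where i: "i \<in> I" using two_points by blast
  note ei = e_closed[OF i]
  let ?u = "tens [e i]" and ?S = "subring_bimod B A"
  have "\<pi> i \<in> hom (add_monoid A) (add_monoid A)" using i by (auto simp: hom_def \<pi>_closed \<pi>_add)
  from tensor_1_universal[OF abelian_group_axioms this]
  obtain \<beta> where \<beta>: "\<beta> \<in> hom (add_monoid (T 1)) (add_monoid A)"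
    and \<beta>t: "\<forall>a \<in> carrier A. \<beta> (tens [a]) = \<pi> i a" by blast
  have u: "?u \<in> carrier (T 1)" by (rule add_hom_closed[OF tens_1_hom ei])
  have f: "\<exists>b\<in>J. f ?u = lact ?S b \<one>" if f: "f \<in> bimod_hom AB AB (T 1) ?S" for f
  proof -
    have fl: "f (lact (T 1) x X) = x \<otimes> f X" and fr: "f (ract (T 1) X x) = f X \<otimes> x"
      if "x \<in> B" "X \<in> carrier (T 1)" for x X
      using f that by (auto simp: bimod_hom_def subring_bimod_def)
    have fB: "f ?u \<in> B" using f add_hom_closed[of f "T 1" ?S] u by (auto simp: bimod_hom_def subring_bimod_def)
    have f0: "f (tens [\<zero>]) = \<zero>"
      using bimod_hom_zero[OF f bimodule_T(3) bimodule_subring_bimod]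
        add_hom_zero[OF tens_1_hom abelian_group_axioms abelian_group_tensor_power]
      by (simp add: subring_bimod_def del: One_nat_def)
    obtain x where x: "x \<in> J" "(x \<otimes> e i = \<zero> \<and> (\<forall>b\<in>B. x \<otimes> b = \<zero> \<longrightarrow> b \<in> J)) \<or>
      (e i \<otimes> x = \<zero> \<and> (\<forall>b\<in>B. b \<otimes> x = \<zero> \<longrightarrow> b \<in> J))"
      using vertex_no_loop[OF i] by blast
    then have xB: "x \<in> B" and xA: "x \<in> carrier A" using J_B B_closed by auto
    have "f ?u \<in> J"
      using x(2) fl[OF xB u] fr[OF xB u] fB f0 lact_tens_1[OF xA ei] ract_tens_1[OF xA ei] by auto
    moreover have "f ?u = lact ?S (f ?u) \<one>" using fB B_closed by (simp add: subring_bimod_def)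
    ultimately show ?thesis by blast
  qed
  show ?thesis
  proof (rule not_bimod_divides_power[where u = "?u" and n = \<one> and J = J and \<beta> = \<beta> and C = A])
    show "\<one> \<in> carrier ?S" using one_B by (simp add: subring_bimod_def)
    show "\<beta> (lact (T 1) b y) = \<zero>" if "b \<in> J" "y \<in> carrier (T 1)" for b y
    proof (rule vanishing_on_JT[OF \<beta> _ that])
      fix xs assume "xs \<in> tensor_gens A 1"
      then show "\<beta> (tens ((b \<otimes> hd xs) # tl xs)) = \<zero>"
        using \<beta>t i \<pi>_J J_mult(2)[OF that(1)] J_B B_closed by (auto simp: tensor_gens_1 simp del: One_nat_def)
    qed simp
    show "\<beta> ?u \<noteq> \<zero>" using \<beta>t ei \<pi>_e i one_not_zero by simp
  qed (use f u \<beta> J_sub in \<open>auto simp: bimodule_T bimodule_subring_bimod abelian_group_axioms simp del: One_nat_def\<close>)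
qed

text \<open>Depth 1 fails by \<open>algebra_not_divides\<close> and depth 3 by
  \<open>tensor_square_not_divides\<close>. Left or right depth 2 would restrict to the same
  divisibility over \<open>B\<close> and \<open>B\<close> that rules out depth 3.\<close>

lemma min_depth_eq_4: "min_depth B A = 4"
proof -
  let ?S = "{enat k |k. (\<exists>m. k = 2 * m + 1 \<and> odd_depth B A m) \<or>
    (\<exists>m\<ge>1. k = 2 * m \<and> (left_even_depth B A m \<or> right_even_depth B A m))}"
  have d1: "\<not> odd_depth B A 0"
    using algebra_not_divides by (auto simp: odd_depth_def H_equivalent_def simp del: One_nat_def)
  have d3: "\<not> odd_depth B A 1"
    using tensor_square_not_divides by (auto simp: odd_depth_def H_equivalent_def one_add_one simp del: One_nat_def)
  \<comment> \<open>\<open>bimod_divides_subring\<close> restricts both sides, so on the side that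
    already is \<open>B\<close> the restriction is along \<open>B\<close> in itself.\<close>
  have sub: "subring B AB" 
    using ring.carrier_is_subring[OF subring_is_ring[OF subring_B]] by simp
  have "\<not> left_even_depth B A 1"
    using tensor_square_not_divides bimod_divides_subring[OF _ sub subring_B]
    by (auto simp: left_even_depth_def H_equivalent_def one_add_one simp del: One_nat_def)
  moreover have "\<not> right_even_depth B A 1"
    using tensor_square_not_divides bimod_divides_subring[OF _ subring_B sub]
    by (auto simp: right_even_depth_def H_equivalent_def one_add_one simp del: One_nat_def)
  ultimately have ge: "4 \<le> k" if "k = 2 * m + 1 \<and> odd_depth B A m \<or>
      m \<ge> 1 \<and> k = 2 * m \<and> (left_even_depth B A m \<or> right_even_depth B A m)" for k m
    using that d1 d3 by (cases "m = 0"; cases "m = 1") auto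
  have "4 \<le> Inf ?S"
  proof (rule Inf_greatest)
    fix x assume "x \<in> ?S"
    then obtain k where "x = enat k" "4 \<le> k" using ge by blast
    then show "4 \<le> x" by (simp add: numeral_eq_enat)
  qed
  \<comment> \<open>At even values \<open>min_depth\<close> accepts either side, so right depth 4
    suffices.\<close>
  moreover have "Inf ?S \<le> 4"
    using right_depth_4 by (intro Inf_lower) (auto simp: numeral_eq_enat intro!: exI[of _ 2])
  ultimately show ?thesis unfolding min_depth_def by (intro antisym) auto
qed

end

section \<open>The path algebra\<close>

text \<open>A finitely supported function is the sum of its values at single points. Bounding the
  support by \<open>S\<close> makes membership in \<open>paths Q\<close> available in the case of a
  single point.\<close>

lemma poly_mapping_carrier_induct [consumes 1, case_names zero single add]:
  fixes f :: "'a \<Rightarrow>\<^sub>0 'b::comm_monoid_add"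
  assumes "Poly_Mapping.keys f \<subseteq> S"
    and zero: "P 0"
    and single: "\<And>x c. x \<in> S \<Longrightarrow> P (Poly_Mapping.single x c)"
    and add: "\<And>f g. P f \<Longrightarrow> P g \<Longrightarrow> P (f + g)"
  shows "P f"
proof -
  have "P (\<Sum>x\<in>X. Poly_Mapping.single x (Poly_Mapping.lookup f x))" if "finite X" "X \<subseteq> S" for X
    using that by (induction X rule: finite_induct) (auto intro: zero single add)
  moreover have "f = (\<Sum>x\<in>Poly_Mapping.keys f. Poly_Mapping.single x (Poly_Mapping.lookup f x))"
    by (rule poly_mapping_eqI) (simp add: lookup_sum lookup_single when_def in_keys_iff)
  ultimately show ?thesis using assms(1) by (metis finite_keys)
qed

lemma lookup_pscale [simp]: "Poly_Mapping.lookup (pscale c f) x = c * Poly_Mapping.lookup f x"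
  by (simp add: pscale_def map.rep_eq when_def)

lemma pscale_simps [simp]:
  "pscale 0 f = 0" "pscale c 0 = 0" "pscale 1 f = f" "pscale c (pscale d f) = pscale (c * d) f"
  "pscale c (Poly_Mapping.single x d) = Poly_Mapping.single x (c * d)"
  by (rule poly_mapping_eqI, simp add: lookup_single when_def)+

lemma pscale_add: "pscale c (f + g) = pscale c f + pscale c g" "pscale (c + d) f = pscale c f + pscale d f"
  by (rule poly_mapping_eqI, simp add: lookup_add algebra_simps)+

lemma keys_pscale: "Poly_Mapping.keys (pscale c f) \<subseteq> Poly_Mapping.keys f"
  by (auto simp: in_keys_iff)

text \<open>The product of \<open>path_algebra\<close> detached from the quiver: bilinearity and
  associativity hold for all finitely supported functions on triples, whether or not the triples are
  paths.\<close>

definition pmul :: "('v \<times> 'e list \<times> 'v \<Rightarrow>\<^sub>0 'k::field) \<Rightarrow> ('v \<times> 'e list \<times> 'v \<Rightarrow>\<^sub>0 'k)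
    \<Rightarrow> ('v \<times> 'e list \<times> 'v \<Rightarrow>\<^sub>0 'k)" where
  "pmul f g = (\<Sum>x\<in>Poly_Mapping.keys f. \<Sum>y\<in>Poly_Mapping.keys g.
    pscale (Poly_Mapping.lookup f x * Poly_Mapping.lookup g y) (path_mult x y))"

text \<open>Points outside the supports contribute zero. Enlarging the sums to common index sets is
  what makes products of elements with different supports comparable.\<close>

lemma pmul_superset:
  assumes "finite X" "finite Y" "Poly_Mapping.keys f \<subseteq> X" "Poly_Mapping.keys g \<subseteq> Y"
  shows "pmul f g = (\<Sum>x\<in>X. \<Sum>y\<in>Y. pscale (Poly_Mapping.lookup f x * Poly_Mapping.lookup g y) (path_mult x y))"
proof -
  have "pmul f g = (\<Sum>x\<in>Poly_Mapping.keys f. \<Sum>y\<in>Y.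
      pscale (Poly_Mapping.lookup f x * Poly_Mapping.lookup g y) (path_mult x y))"
    unfolding pmul_def using assms
    by (intro sum.cong refl sum.mono_neutral_left) (auto simp: in_keys_iff)
  also have "\<dots> = (\<Sum>x\<in>X. \<Sum>y\<in>Y. pscale (Poly_Mapping.lookup f x * Poly_Mapping.lookup g y) (path_mult x y))"
    using assms by (intro sum.mono_neutral_left) (auto simp: in_keys_iff)
  finally show ?thesis .
qed

lemma pmul_add_left: "pmul (f + f') g = pmul f g + pmul f' g"
proof -
  let ?X = "Poly_Mapping.keys f \<union> Poly_Mapping.keys f'"
  have *: "Poly_Mapping.keys (f + f') \<subseteq> ?X" by (rule keys_add)
  show ?thesis
    using * by (simp add: pmul_superset[where X = ?X and Y = "Poly_Mapping.keys g"] lookup_add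
        distrib_right pscale_add sum.distrib)
qed

lemma pmul_add_right: "pmul f (g + g') = pmul f g + pmul f g'"
proof -
  let ?Y = "Poly_Mapping.keys g \<union> Poly_Mapping.keys g'"
  have *: "Poly_Mapping.keys (g + g') \<subseteq> ?Y" by (rule keys_add)
  show ?thesis
    using * by (simp add: pmul_superset[where Y = ?Y and X = "Poly_Mapping.keys f"] lookup_add
        distrib_left pscale_add sum.distrib)
qed

lemma pmul_zero [simp]: "pmul 0 g = 0" "pmul f 0 = 0"
  by (simp_all add: pmul_def)

lemma pmul_sum_left: "pmul (sum f X) g = (\<Sum>x\<in>X. pmul (f x) g)"
  by (induction X rule: infinite_finite_induct) (simp_all add: pmul_add_left)

lemma pmul_sum_right: "pmul g (sum f X) = (\<Sum>x\<in>X. pmul g (f x))"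
  by (induction X rule: infinite_finite_induct) (simp_all add: pmul_add_right)

lemma pmul_single [simp]:
  "pmul (Poly_Mapping.single (a, p, b) k) (Poly_Mapping.single (c, q, d) l) =
    (if b = c then Poly_Mapping.single (a, p @ q, d) (k * l) else 0)"
  by (subst pmul_superset[where X = "{(a, p, b)}" and Y = "{(c, q, d)}"]) auto

text \<open>Both sides are additive in each argument, so three nested inductions leave single
  triples, where concatenation of lists is associative.\<close>

lemma pmul_assoc: "pmul (pmul f g) h = pmul f (pmul g h)"
proof -
  have "\<forall>g h. pmul (pmul f g) h = pmul f (pmul g h)" if "Poly_Mapping.keys f \<subseteq> UNIV" for f :: "'a \<times> 'b list \<times> 'a \<Rightarrow>\<^sub>0 'c"
    using that
  proof (induction f rule: poly_mapping_carrier_induct)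
    case (single x k)
    have "\<forall>h. pmul (pmul (Poly_Mapping.single x k) g) h = pmul (Poly_Mapping.single x k) (pmul g h)"
      if "Poly_Mapping.keys g \<subseteq> UNIV" for g
      using that
    proof (induction g rule: poly_mapping_carrier_induct)
      case (single y l)
      have "pmul (pmul (Poly_Mapping.single x k) (Poly_Mapping.single y l)) h =
          pmul (Poly_Mapping.single x k) (pmul (Poly_Mapping.single y l) h)"
        if "Poly_Mapping.keys h \<subseteq> UNIV" for h
        using that
      proof (induction h rule: poly_mapping_carrier_induct)
        case (single z m)
        then show ?case by (cases x; cases y; cases z) (auto simp: mult.assoc)
      qed (simp_all add: pmul_add_right)
      then show ?case by simp
    qed (simp_all add: pmul_add_right pmul_add_left)
    then show ?case by simp
  qed (simp_all add: pmul_add_left)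
  then show ?thesis by simp
qed

lemma pmul_pscale: "pmul (pscale c f) g = pscale c (pmul f g)" "pmul f (pscale c g) = pscale c (pmul f g)"
proof -
  have s: "pscale c (sum h X) = (\<Sum>x\<in>X. pscale c (h x))"
    for h :: "'a \<times> 'b list \<times> 'a \<Rightarrow> 'a \<times> 'b list \<times> 'a \<Rightarrow>\<^sub>0 'c" and X
    by (induction X rule: infinite_finite_induct) (simp_all add: pscale_add)
  show "pmul (pscale c f) g = pscale c (pmul f g)"
    by (simp add: pmul_superset[where X = "Poly_Mapping.keys f" and Y = "Poly_Mapping.keys g"] keys_pscale s mult.assoc)
  show "pmul f (pscale c g) = pscale c (pmul f g)"
    by (simp add: pmul_superset[where X = "Poly_Mapping.keys f" and Y = "Poly_Mapping.keys g"] keys_pscale s mult_ac)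
qed

section \<open>Paths and the coefficients of stationary paths\<close>

lemma paths_iff:
  "(u, p, v) \<in> paths Q \<longleftrightarrow> u \<in> verts Q \<and> set p \<subseteq> arcs Q \<and> pre_digraph.cas Q u p v"
  by (simp add: paths_def pre_digraph.awalk_def)

lemma paths_stationary: "(u, [], v) \<in> paths Q \<longleftrightarrow> u \<in> verts Q \<and> u = v"
  by (simp add: paths_iff pre_digraph.cas.simps)

lemma paths_append:
  assumes "wf_digraph Q" "(u, p, v) \<in> paths Q" "(v, q, w) \<in> paths Q"
  shows "(u, p @ q, w) \<in> paths Q"
  using wf_digraph.awalk_appendI[OF assms(1)] assms(2,3) by (auto simp: paths_def)

definition vert_coeff :: "'v \<Rightarrow> ('v \<times> 'e list \<times> 'v \<Rightarrow>\<^sub>0 'k::field) \<Rightarrow> 'k" where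
  "vert_coeff v f = Poly_Mapping.lookup f (v, [], v)"

lemma vert_coeff_simps [simp]:
  "vert_coeff v 0 = 0" "vert_coeff v (f + g) = vert_coeff v f + vert_coeff v g"
  "vert_coeff v (f - g) = vert_coeff v f - vert_coeff v g"
  "vert_coeff v (- f) = - vert_coeff v f"
  "vert_coeff v (pscale c f) = c * vert_coeff v f"
  "vert_coeff v (Poly_Mapping.single x c) = (if x = (v, [], v) then c else 0)"
  by (auto simp: vert_coeff_def lookup_add lookup_minus lookup_single when_def)

lemma vert_coeff_sum: "vert_coeff v (sum f X) = (\<Sum>x\<in>X. vert_coeff v (f x))"
  by (simp add: vert_coeff_def lookup_sum)

text \<open>A concatenation of paths is stationary only if both factors are. Support in
  \<open>paths Q\<close> excludes triples \<open>(u, [], v)\<close> with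
  \<open>u \<noteq> v\<close>, whose products could also be stationary.\<close>

lemma vert_coeff_pmul:
  assumes "Poly_Mapping.keys f \<subseteq> paths Q" "Poly_Mapping.keys g \<subseteq> paths Q"
  shows "vert_coeff v (pmul f g) = vert_coeff v f * vert_coeff v g"
  using assms(1)
proof (induction f rule: poly_mapping_carrier_induct)
  case (single x k)
  show ?case using assms(2)
  proof (induction g rule: poly_mapping_carrier_induct)
    case (single y l)
    then show ?case using \<open>x \<in> paths Q\<close>
      by (cases x; cases y) (auto simp: paths_stationary)
  qed (simp_all add: pmul_add_right distrib_left)
qed (simp_all add: pmul_add_left distrib_right)

text \<open>Left multiplication by an arrow yields that arrow itself only from the stationary path
  at its head. So an element annihilated by the arrow has coefficient zero there; the next lemma
  does the same at the tail.\<close>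

lemma lookup_pmul_arrow_left:
  "Poly_Mapping.lookup (pmul (Poly_Mapping.single (t, [a], h) 1) f) (t, [a], h) = vert_coeff h f"
proof -
  have "Poly_Mapping.keys f \<subseteq> UNIV" by simp
  then show ?thesis
  proof (induction f rule: poly_mapping_carrier_induct)
    case (single x k)
    then show ?case by (cases x) (auto simp: lookup_single when_def)
  qed (simp_all add: pmul_add_right lookup_add)
qed

lemma lookup_pmul_arrow_right:
  "Poly_Mapping.lookup (pmul f (Poly_Mapping.single (t, [a], h) 1)) (t, [a], h) = vert_coeff t f"
proof -
  have "Poly_Mapping.keys f \<subseteq> UNIV" by simp
  then show ?thesis
  proof (induction f rule: poly_mapping_carrier_induct)
    case (single x k)
    then show ?case by (cases x) (auto simp: lookup_single when_def)
  qed (simp_all add: pmul_add_left lookup_add)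
qed

lemma path_algebra_sel:
  "carrier (path_algebra Q) = {f. Poly_Mapping.keys f \<subseteq> paths Q}"
  "mult (path_algebra Q) = pmul"
  "\<one>\<^bsub>path_algebra Q\<^esub> = (\<Sum>v\<in>verts Q. Poly_Mapping.single (v, [], v) 1)"
  "\<zero>\<^bsub>path_algebra Q\<^esub> = 0"
  "add (path_algebra Q) = (+)"
  by (auto simp: path_algebra_def pmul_def fun_eq_iff)

section \<open>The path algebra as a ring\<close>

context
  fixes Q :: "('v, 'e) pre_digraph" and A :: "('v \<times> 'e list \<times> 'v \<Rightarrow>\<^sub>0 'k::field) ring"
  assumes Q: "fin_digraph Q"
  defines "A \<equiv> path_algebra Q"
begin

interpretation Q: fin_digraph Q by (rule Q)

lemma A_sel:
  "carrier A = {f. Poly_Mapping.keys f \<subseteq> paths Q}"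
  "mult A = pmul"
  "\<one>\<^bsub>A\<^esub> = (\<Sum>v\<in>verts Q. Poly_Mapping.single (v, [], v) 1)"
  "\<zero>\<^bsub>A\<^esub> = 0"
  "add A = (+)"
  by (simp_all add: A_def path_algebra_sel)

lemma pmul_closed:
  assumes "f \<in> carrier A" "g \<in> carrier A"
  shows "pmul f g \<in> carrier A"
proof -
  have add: "f + g \<in> carrier A" if "f \<in> carrier A" "g \<in> carrier A" for f g
    using that keys_add[of f g] by (auto simp: A_sel)
  have "Poly_Mapping.keys f \<subseteq> paths Q" using assms by (simp add: A_sel)
  then show ?thesis
  proof (induction f rule: poly_mapping_carrier_induct)
    case (single x k)
    have "Poly_Mapping.keys g \<subseteq> paths Q" using assms by (simp add: A_sel)
    then show ?case
    proof (induction g rule: poly_mapping_carrier_induct)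
      case (single y l)
      then show ?case using \<open>x \<in> paths Q\<close>
        by (cases x; cases y) (auto simp: A_sel intro: paths_append[OF Q.wf_digraph_axioms])
    qed (auto simp: pmul_add_right add, simp add: A_sel)
  qed (auto simp: pmul_add_left add, simp add: A_sel)
qed

lemma one_pmul: "f \<in> carrier A \<Longrightarrow> pmul \<one>\<^bsub>A\<^esub> f = f" and pmul_one: "f \<in> carrier A \<Longrightarrow> pmul f \<one>\<^bsub>A\<^esub> = f"
proof -
  \<comment> \<open>Both ends of a path are vertices, so exactly one summand of the unit acts on it,
    as the identity.\<close>
  have end_verts: "u \<in> verts Q \<and> w \<in> verts Q" if "(u, p, w) \<in> paths Q" for u p w
    using that Q.awalk_last_in_verts Q.awalkE unfolding paths_def by blast
  show "pmul \<one>\<^bsub>A\<^esub> f = f" if "f \<in> carrier A"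
    using that[unfolded A_sel, simplified]
  proof (induction f rule: poly_mapping_carrier_induct)
    case (single x k)
    then show ?case
      using end_verts by (cases x) (auto simp: A_sel pmul_sum_left sum.delta)
  qed (simp_all add: pmul_add_right)
  show "pmul f \<one>\<^bsub>A\<^esub> = f" if "f \<in> carrier A"
    using that[unfolded A_sel, simplified]
  proof (induction f rule: poly_mapping_carrier_induct)
    case (single x k)
    then show ?case
      using end_verts by (cases x) (auto simp: A_sel pmul_sum_right sum.delta)
  qed (simp_all add: pmul_add_left)
qed

lemma one_closed_path_algebra: "\<one>\<^bsub>A\<^esub> \<in> carrier A"
  using keys_sum[of "\<lambda>v. Poly_Mapping.single (v, [], v) (1::'k)" "verts Q"]
  by (auto simp: A_sel paths_stationary)

lemma ring_path_algebra: "ring A"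
proof (rule ringI)
  show "abelian_group A"
  proof (rule abelian_groupI)
    fix f assume "f \<in> carrier A"
    then show "\<exists>g\<in>carrier A. g \<oplus>\<^bsub>A\<^esub> f = \<zero>\<^bsub>A\<^esub>"
      by (intro bexI[of _ "- f"]) (auto simp: A_sel)
  next
    fix f g assume "f \<in> carrier A" "g \<in> carrier A"
    then show "f \<oplus>\<^bsub>A\<^esub> g \<in> carrier A" using keys_add[of f g] by (auto simp: A_sel)
  qed (auto simp: A_sel ac_simps)
  show "monoid A"
    by (rule monoidI) (simp_all add: A_sel(2) pmul_closed one_closed_path_algebra one_pmul pmul_one pmul_assoc)
qed (simp_all add: A_sel pmul_add_left pmul_add_right)

interpretation A: ring A by (rule ring_path_algebra)

lemma minus_path_algebra: "f \<in> carrier A \<Longrightarrow> g \<in> carrier A \<Longrightarrow> f \<ominus>\<^bsub>A\<^esub> g = f - g"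
proof -
  assume f: "f \<in> carrier A" and g: "g \<in> carrier A"
  have "\<ominus>\<^bsub>A\<^esub> g = - g"
    by (rule A.minus_equality) (use g in \<open>auto simp: A_sel\<close>)
  then show ?thesis by (simp add: a_minus_def A_sel)
qed

lemma uminus_path_algebra: "g \<in> carrier A \<Longrightarrow> \<ominus>\<^bsub>A\<^esub> g = - g"
  by (rule A.minus_equality) (auto simp: A_sel)

lemma finsum_path_algebra: "(\<And>x. x \<in> X \<Longrightarrow> f x \<in> carrier A) \<Longrightarrow> finsum A f X = sum f X"
  by (induction X rule: infinite_finite_induct) (auto simp: A_sel(4,5))

lemma pscale_closed: "f \<in> carrier A \<Longrightarrow> pscale c f \<in> carrier A"
  using keys_pscale[of c f] by (auto simp: A_sel)

section \<open>The radical and the primary arrow subalgebra in terms of stationary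
  coefficients\<close>

lemma vert_coeff_mult: "f \<in> carrier A \<Longrightarrow> g \<in> carrier A \<Longrightarrow> vert_coeff v (pmul f g) = vert_coeff v f * vert_coeff v g"
  by (rule vert_coeff_pmul[of _ Q]) (auto simp: A_sel)

lemma vert_coeff_one: "v \<in> verts Q \<Longrightarrow> vert_coeff v \<one>\<^bsub>A\<^esub> = 1"
  by (simp add: A_sel vert_coeff_sum eq_commute[of _ v] sum.delta)

text \<open>A path of length zero in the support would be stationary at a vertex and have a nonzero
  coefficient. This presents the radical as the common kernel of the multiplicative functionals
  \<open>vert_coeff v\<close>, from which the ideal property follows.\<close>

lemma path_rad_iff: "f \<in> path_rad Q \<longleftrightarrow> f \<in> carrier A \<and> (\<forall>v\<in>verts Q. vert_coeff v f = 0)"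
proof
  assume "f \<in> path_rad Q"
  then show "f \<in> carrier A \<and> (\<forall>v\<in>verts Q. vert_coeff v f = 0)"
    by (fastforce simp: path_rad_def A_sel vert_coeff_def in_keys_iff)
next
  assume r: "f \<in> carrier A \<and> (\<forall>v\<in>verts Q. vert_coeff v f = 0)"
  have "length p \<ge> 1" if "(u, p, v) \<in> Poly_Mapping.keys f" for u p v
  proof (cases p)
    case Nil
    then have "u \<in> verts Q \<and> u = v" using that r paths_stationary[of u v Q] by (auto simp: A_sel)
    then show ?thesis using that r Nil by (auto simp: vert_coeff_def in_keys_iff)
  qed simp
  then show "f \<in> path_rad Q" using r by (auto simp: path_rad_def A_sel)
qed

lemma path_rad_ideal: "ideal (path_rad Q) A"
proof (rule idealI[OF ring_path_algebra])
  show "subgroup (path_rad Q) (add_monoid A)"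
  proof (rule A.add.subgroupI)
    show "path_rad Q \<noteq> ({} :: ('v \<times> 'e list \<times> 'v \<Rightarrow>\<^sub>0 'k) set)"
    proof -
      have "(0 :: 'v \<times> 'e list \<times> 'v \<Rightarrow>\<^sub>0 'k) \<in> path_rad Q"
        using A.zero_closed by (simp add: path_rad_iff A_sel)
      then show ?thesis by blast
    qed
  next
    fix f :: "'v \<times> 'e list \<times> 'v \<Rightarrow>\<^sub>0 'k" assume "f \<in> path_rad Q"
    then show "\<ominus>\<^bsub>A\<^esub> f \<in> path_rad Q"
      using A.a_inv_closed[of f] uminus_path_algebra[of f] by (auto simp: path_rad_iff)
  next
    fix f g :: "'v \<times> 'e list \<times> 'v \<Rightarrow>\<^sub>0 'k" assume "f \<in> path_rad Q" "g \<in> path_rad Q"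
    then show "f \<oplus>\<^bsub>A\<^esub> g \<in> path_rad Q"
      using A.a_closed[of f g] by (auto simp: path_rad_iff A_sel(5))
  qed (auto simp: path_rad_iff)
next
  fix f g :: "'v \<times> 'e list \<times> 'v \<Rightarrow>\<^sub>0 'k" assume "f \<in> path_rad Q" "g \<in> carrier A"
  then show "g \<otimes>\<^bsub>A\<^esub> f \<in> path_rad Q" "f \<otimes>\<^bsub>A\<^esub> g \<in> path_rad Q"
    by (auto simp: path_rad_iff A_sel(2) pmul_closed vert_coeff_mult)
qed

text \<open>Subtracting the common coefficient times the unit leaves an element of the radical. In
  this form the subring laws for \<open>B\<close>, and the agreement of all stationary coefficients
  on it, can be read off.\<close>

lemma primary_arrow_subalgebra_iff:
  "f \<in> primary_arrow_subalgebra Q \<longleftrightarrow> f \<in> carrier A \<and> (\<exists>c. \<forall>v\<in>verts Q. vert_coeff v f = c)"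
proof
  assume "f \<in> primary_arrow_subalgebra Q"
  then obtain c g where "f = pscale c \<one>\<^bsub>A\<^esub> + g" "g \<in> path_rad Q"
    by (auto simp: primary_arrow_subalgebra_def A_def)
  then show "f \<in> carrier A \<and> (\<exists>c. \<forall>v\<in>verts Q. vert_coeff v f = c)"
    using A.a_closed[OF pscale_closed[OF one_closed_path_algebra], of g c]
    by (auto simp: path_rad_iff vert_coeff_one A_sel(5))
next
  assume "f \<in> carrier A \<and> (\<exists>c. \<forall>v\<in>verts Q. vert_coeff v f = c)"
  then obtain c where f: "f \<in> carrier A" "\<forall>v\<in>verts Q. vert_coeff v f = c" by blast
  let ?s = "pscale c \<one>\<^bsub>A\<^esub>"
  have s: "?s \<in> carrier A" by (rule pscale_closed[OF one_closed_path_algebra])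
  have "f - ?s \<in> path_rad Q"
    using f A.minus_closed[OF _ s, of f] minus_path_algebra[OF _ s, of f] by (auto simp: path_rad_iff vert_coeff_one)
  then show "f \<in> primary_arrow_subalgebra Q"
    unfolding primary_arrow_subalgebra_def A_def[symmetric]
    by (intro CollectI exI[of _ c] exI[of _ "f - ?s"]) simp
qed

section \<open>The path algebra as an instance of \<open>primary_subring\<close>\<close>

lemma ex_incident_arc:
  assumes conn: "Digraph_Component.connected Q" and card: "card (verts Q) > 1" and v: "v \<in> verts Q"
  shows "\<exists>a\<in>arcs Q. tail Q a = v \<or> head Q a = v"
proof -
  have "verts Q \<noteq> {v}" using card by auto
  then obtain w where w: "w \<in> verts Q" "w \<noteq> v" using v by blast
  have "v \<rightarrow>\<^sup>*\<^bsub>mk_symmetric Q\<^esub> w"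
    using conn v w by (auto simp: Digraph_Component.connected_def strongly_connected_def)
  then have "(v, w) \<in> (arcs_ends (mk_symmetric Q))\<^sup>*" by (rule reachable_rtranclI)
  \<comment> \<open>As \<open>w \<noteq> v\<close>, the walk in the symmetric closure has a first
    step, which comes from an arc of \<open>Q\<close> at \<open>v\<close> in one direction or the
    other.\<close>
  then obtain z where "(v, z) \<in> arcs_ends (mk_symmetric Q)"
    using w(2) by (auto elim: converse_rtranclE)
  then show ?thesis by (auto simp: arcs_ends_conv parcs_mk_symmetric)
qed

text \<open>The coefficient at \<open>v\<close> is embedded as a multiple of the unit, so it is
  central and lies in \<open>B\<close>. Connectedness supplies the arrow at each vertex that
  \<open>vertex_arrow\<close> and \<open>vertex_no_loop\<close> ask for.\<close>

lemma primary_subring_path_algebra: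
  assumes conn: "Digraph_Component.connected Q" and acyclic: "acyclic_quiver Q" and card: "card (verts Q) > 1"
  shows "primary_subring A (primary_arrow_subalgebra Q) (verts Q) (\<lambda>v. Poly_Mapping.single (v, [], v) 1)
    (\<lambda>v f. pscale (vert_coeff v f) \<one>\<^bsub>A\<^esub>) (path_rad Q)"
proof -
  let ?B = "primary_arrow_subalgebra Q :: ('v \<times> 'e list \<times> 'v \<Rightarrow>\<^sub>0 'k) set"
  let ?e = "\<lambda>v. Poly_Mapping.single (v, [], v) (1::'k)"
  obtain w where w: "w \<in> verts Q" using card by (metis card.empty ex_in_conv not_one_less_zero)
  note B_iff = primary_arrow_subalgebra_iff
  note one = one_closed_path_algebra
  have scal: "pscale c \<one>\<^bsub>A\<^esub> \<in> carrier A" for c by (rule pscale_closed[OF one])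
  have e: "?e v \<in> carrier A" if "v \<in> verts Q" for v using that by (simp add: A_sel paths_stationary)
  have scal_mult: "pmul (pscale c \<one>\<^bsub>A\<^esub>) f = pscale c f" "pmul f (pscale c \<one>\<^bsub>A\<^esub>) = pscale c f"
    if "f \<in> carrier A" for c f
    using that by (simp_all add: pmul_pscale one_pmul pmul_one)
  \<comment> \<open>Acyclicity enters here: a loop would be a cycle with one arrow.\<close>
  have no_loop: "tail Q a \<noteq> head Q a" if a: "a \<in> arcs Q" for a
  proof
    assume "tail Q a = head Q a"
    then have "pre_digraph.cycle Q [a]"
      using a Q.tail_in_verts[OF a] unfolding Q.cycle_def Q.awalk_def by (intro exI[of _ "tail Q a"]) simp
    then show False using acyclic by (auto simp: acyclic_quiver_def)
  qed
  have arrow: "Poly_Mapping.single (tail Q a, [a], head Q a) 1 \<in> path_rad Q" if "a \<in> arcs Q" for a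
    using that Q.tail_in_verts[OF that]
    by (auto simp: path_rad_def paths_iff Q.cas.simps)
  have sub: "subring ?B A"
  proof (rule A.subringI)
    fix f g assume fg: "f \<in> ?B" "g \<in> ?B"
    then show "f \<otimes>\<^bsub>A\<^esub> g \<in> ?B" using w by (auto simp: B_iff A_sel(2) pmul_closed vert_coeff_mult)
    show "f \<oplus>\<^bsub>A\<^esub> g \<in> ?B" using fg A.a_closed[of f g] by (auto simp: B_iff A_sel(5))
  next
    fix f assume "f \<in> ?B"
    then show "\<ominus>\<^bsub>A\<^esub> f \<in> ?B" using A.a_inv_closed[of f] uminus_path_algebra[of f] by (auto simp: B_iff)
  qed (auto simp: B_iff one vert_coeff_one w)
  have B_rad: "b \<in> path_rad Q" if "b \<in> ?B" "v \<in> verts Q" "vert_coeff v b = 0" for b v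
    using that by (auto simp: B_iff path_rad_iff)
  show ?thesis
  proof (intro primary_subring.intro subring_tensor.intro subring_tensor_axioms.intro
      primary_subring_axioms.intro ring_path_algebra sub path_rad_ideal)
    show "\<exists>i\<in>verts Q. \<exists>j\<in>verts Q. i \<noteq> j"
      using card w by (metis card_le_Suc0_iff_eq Q.finite_verts not_less One_nat_def)
    show "\<one>\<^bsub>A\<^esub> \<noteq> \<zero>\<^bsub>A\<^esub>" using vert_coeff_one[OF w] by (auto simp: A_sel(4))
    show "path_rad Q \<subseteq> ?B" by (auto simp: B_iff path_rad_iff w)
  next
    fix c assume c: "c \<in> carrier A"
    let ?t = "\<lambda>k. pscale (vert_coeff k c) \<one>\<^bsub>A\<^esub> \<otimes>\<^bsub>A\<^esub> ?e k"
    have t: "?t k \<in> carrier A" if "k \<in> verts Q" for k using scal e[OF that] by (rule A.m_closed)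
    have s: "finsum A ?t (verts Q) = sum ?t (verts Q)" by (rule finsum_path_algebra[OF t])
    have sc: "finsum A ?t (verts Q) \<in> carrier A" using t by (intro A.finsum_closed) auto
    \<comment> \<open>Only the summand at \<open>v\<close> contributes, so \<open>c\<close> and the
      sum have equal stationary coefficients and differ by an element of the radical.\<close>
    have "vert_coeff v (sum ?t (verts Q)) = vert_coeff v c" if "v \<in> verts Q" for v
      using that e by (simp add: vert_coeff_sum A_sel(2) scal_mult if_distrib eq_commute[of _ v] sum.delta cong: if_cong)
    moreover have "c \<ominus>\<^bsub>A\<^esub> finsum A ?t (verts Q) = c - sum ?t (verts Q)"
      by (subst minus_path_algebra[OF c sc]) (simp only: s)
    ultimately show "c \<ominus>\<^bsub>A\<^esub> finsum A ?t (verts Q) \<in> path_rad Q"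
      using A.minus_closed[OF c sc] unfolding path_rad_iff by simp
  next
    fix v assume v: "v \<in> verts Q"
    obtain a where a: "a \<in> arcs Q" "tail Q a = v \<or> head Q a = v"
      using ex_incident_arc[OF conn card v] by blast
    let ?x = "Poly_Mapping.single (tail Q a, [a], head Q a) (1::'k)"
    note ends = Q.tail_in_verts[OF a(1)] Q.head_in_verts[OF a(1)]
    \<comment> \<open>The arrow detects the coefficient at its head from the left and the one at its
      tail from the right; one of the two is \<open>v\<close>.\<close>
    have l: "vert_coeff (head Q a) u = 0" if "?x \<otimes>\<^bsub>A\<^esub> u = \<zero>\<^bsub>A\<^esub>" for u
      using that lookup_pmul_arrow_left[of "tail Q a" a "head Q a" u] by (simp add: A_sel)
    have r: "vert_coeff (tail Q a) u = 0" if "u \<otimes>\<^bsub>A\<^esub> ?x = \<zero>\<^bsub>A\<^esub>" for u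
      using that lookup_pmul_arrow_right[of u "tail Q a" a "head Q a"] by (simp add: A_sel)
    show "\<exists>x\<in>path_rad Q. \<forall>u\<in>carrier A. x \<otimes>\<^bsub>A\<^esub> u = \<zero>\<^bsub>A\<^esub> \<longrightarrow> u \<otimes>\<^bsub>A\<^esub> x = \<zero>\<^bsub>A\<^esub>
        \<longrightarrow> pscale (vert_coeff v u) \<one>\<^bsub>A\<^esub> = \<zero>\<^bsub>A\<^esub>"
      using a(2) l r by (intro bexI[OF _ arrow[OF a(1)]]) (auto simp: A_sel(4))
    \<comment> \<open>If the arrow starts at \<open>v\<close>, its head is a different vertex and
      the product with the stationary path at \<open>v\<close> vanishes. For \<open>b\<close> in
      \<open>B\<close>, annihilation kills the coefficient at the head, and all stationary
      coefficients of \<open>b\<close> are equal. An arrow ending at \<open>v\<close> is treated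
      from the other side.\<close>
    have "?x \<otimes>\<^bsub>A\<^esub> ?e v = \<zero>\<^bsub>A\<^esub> \<and> (\<forall>b\<in>?B. ?x \<otimes>\<^bsub>A\<^esub> b = \<zero>\<^bsub>A\<^esub> \<longrightarrow> b \<in> path_rad Q)" if "tail Q a = v"
      using that no_loop[OF a(1)] l B_rad ends by (auto simp: A_sel(2,4))
    moreover have "?e v \<otimes>\<^bsub>A\<^esub> ?x = \<zero>\<^bsub>A\<^esub> \<and> (\<forall>b\<in>?B. b \<otimes>\<^bsub>A\<^esub> ?x = \<zero>\<^bsub>A\<^esub> \<longrightarrow> b \<in> path_rad Q)" if "head Q a = v"
      using that no_loop[OF a(1)] r B_rad ends by (auto simp: A_sel(2,4))
    ultimately show "\<exists>x\<in>path_rad Q. (x \<otimes>\<^bsub>A\<^esub> ?e v = \<zero>\<^bsub>A\<^esub> \<and> (\<forall>b\<in>?B. x \<otimes>\<^bsub>A\<^esub> b = \<zero>\<^bsub>A\<^esub> \<longrightarrow> b \<in> path_rad Q)) \<or>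
        (?e v \<otimes>\<^bsub>A\<^esub> x = \<zero>\<^bsub>A\<^esub> \<and> (\<forall>b\<in>?B. b \<otimes>\<^bsub>A\<^esub> x = \<zero>\<^bsub>A\<^esub> \<longrightarrow> b \<in> path_rad Q))"
      using a(2) by (intro bexI[OF _ arrow[OF a(1)]]) blast
  next
    fix v x assume v: "v \<in> verts Q" and x: "x \<in> ?B"
    then have xc: "x \<in> carrier A" by (simp add: B_iff)
    have "x \<ominus>\<^bsub>A\<^esub> pscale (vert_coeff v x) \<one>\<^bsub>A\<^esub> \<in> carrier A" using xc scal by (rule A.minus_closed)
    then show "x \<ominus>\<^bsub>A\<^esub> pscale (vert_coeff v x) \<one>\<^bsub>A\<^esub> \<in> path_rad Q"
      using v x by (auto simp: path_rad_iff minus_path_algebra[OF xc scal] vert_coeff_one B_iff)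
  qed (auto simp: e A_sel(2,4,5) scal scal_mult vert_coeff_mult vert_coeff_one B_iff w pscale_add path_rad_iff pmul_closed
      mult.commute)
qed

end

theorem theorem5p2:
  fixes Q :: "('v, 'e) pre_digraph"
  assumes "fin_digraph Q"
    and "Digraph_Component.connected Q"
    and "acyclic_quiver Q"
    and "card (verts Q) > 1"
  shows "min_depth
      (primary_arrow_subalgebra Q :: ('v \<times> 'e list \<times> 'v \<Rightarrow>\<^sub>0 'k::alg_closed_field) set)
      (path_algebra Q) = 4"
  using primary_subring_path_algebra[OF assms] by (rule primary_subring.min_depth_eq_4)

end
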